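(* Let $f_0\in C^\infty([0,\infty))$ be a monotone solution of \[ f''(y)+\left(\frac{2}{y}-\frac{y}{2}\right)f'(y)-\frac{1}{y^2}\sin(2f(y))=0\ \ (y>0),\qquad f(0)=0,\qquad \lim_{y\to\infty}f(y)\ \text{finite}, \] satisfying $\lVert f_0-\widetilde f_0\rVert\le 5\cdot10^{-4}$ (notation in the context). Let $\mathcal A_0$ be the unique self-adjoint extension on $L^2_\rho(0,\infty)$, $\rho(y)=y^2e^{-y^2/4}$, of the operator \[ \mathcal A_0 w=-\frac{1}{\rho}\partial_y(\rho\,\partial_y w)+\frac{2\cos(2f_0(y))}{y^2}w \] defined on $C_0^\infty(0,\infty)$. Then the only eigenvalue of $\mathcal A_0$ in the interval $(-\infty,0]$ is $-1$.
   Context: Here $\widetilde f_0(y)=2\arctan\big(\sum_{n=0}^{14}(f_0)_nT_{2n+1}(y/\sqrt{2+y^2})\big)$ with $T_m$ the Chebyshev polynomials of the first kind and coefficients $(f_0)_0,\dots,(f_0)_{14}$ equal to $\frac{268245}{72878},\frac{-3174}{105551},\frac{1897}{97022},\frac{14}{72731},\frac{79}{119383},\frac{4}{66337},\frac{5}{109368},\frac{1}{109045},\frac{1}{204079},\frac{1}{675805},\frac{1}{1400761},\frac{1}{3586839},\frac{1}{7289041},\frac{1}{16940631},\frac{1}{59286294}$; the norm is $\lVert f\rVert=\lVert p_1f\rVert_{L^\infty(0,\infty)}+\lVert p_3f'\rVert_{L^\infty(0,\infty)}$ with $p_1(y)=\frac{\sqrt{2+y^2}}{\sqrt2\,y}$,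 $p_3(y)=\frac{(2+y^2)^{3/2}}{2\sqrt2}$. The operator $\mathcal A_0$ on $C_0^\infty(0,\infty)$ is essentially self-adjoint in $L^2_\rho(0,\infty)$, so the extension is unique. *)

theory Defs
  imports "HOL-Analysis.Analysis"
begin

fun cheb_T :: "nat \<Rightarrow> real \<Rightarrow> real" where
  "cheb_T 0 x = 1"
| "cheb_T (Suc 0) x = x"
| "cheb_T (Suc (Suc n)) x = 2 * x * cheb_T (Suc n) x - cheb_T n x"

definition f0_coeffs :: "real list" where
  "f0_coeffs = [268245/72878, -3174/105551, 1897/97022, 14/72731, 79/119383,
     4/66337, 5/109368, 1/109045, 1/204079, 1/675805, 1/1400761, 1/3586839,
     1/7289041, 1/16940631, 1/59286294]"

definition f0_approx :: "real \<Rightarrow> real" where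
  "f0_approx y = 2 * arctan (\<Sum>n<15. (f0_coeffs ! n) * cheb_T (2*n+1) (y / sqrt (2 + y^2)))"

definition p1 :: "real \<Rightarrow> real" where
  "p1 y = sqrt (2 + y^2) / (sqrt 2 * y)"

definition p3 :: "real \<Rightarrow> real" where
  "p3 y = (2 + y^2) powr (3/2) / (2 * sqrt 2)"

definition smooth_tower_halfline :: "(nat \<Rightarrow> real \<Rightarrow> real) \<Rightarrow> (real \<Rightarrow> real) \<Rightarrow> bool" where
  "smooth_tower_halfline D f \<longleftrightarrow> D 0 = f \<and>
     (\<forall>n. \<forall>x\<ge>0. (D n has_real_derivative D (Suc n) x) (at x within {0..}))"

definition test_fun :: "(real \<Rightarrow> real) \<Rightarrow> bool" where
  "test_fun \<phi> \<longleftrightarrow>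
     (\<exists>D. D 0 = \<phi> \<and> (\<forall>n x. (D n has_real_derivative D (Suc n) x) (at x))) \<and>
     (\<exists>a b. 0 < a \<and> a < b \<and> (\<forall>x. x \<notin> {a..b} \<longrightarrow> \<phi> x = 0))"

definition rho :: "real \<Rightarrow> real" where
  "rho y = y^2 * exp (- (y^2) / 4)"

definition L2rho :: "(real \<Rightarrow> real) \<Rightarrow> bool" where
  "L2rho u \<longleftrightarrow> u \<in> borel_measurable lborel \<and>
     set_integrable lborel {0<..} (\<lambda>y. rho y * (u y)^2)"

definition L2rho_norm2 :: "(real \<Rightarrow> real) \<Rightarrow> real" where
  "L2rho_norm2 u = (LINT y:{0<..}|lborel. rho y * (u y)^2)"

definition A0 :: "(real \<Rightarrow> real) \<Rightarrow> (real \<Rightarrow> real) \<Rightarrow> real \<Rightarrow> real" where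
  "A0 f0 w y = - (1 / rho y) * deriv (\<lambda>t. rho t * deriv w t) y
               + 2 * cos (2 * f0 y) / y^2 * w y"

text \<open>Graph of the closure of A_0 on C_0^\<infinity>(0,\<infinity>) in L^2_rho; since A_0 is essentially
  self-adjoint, this closure is its unique self-adjoint extension.\<close>
definition A0_closure_graph :: "(real \<Rightarrow> real) \<Rightarrow> (real \<Rightarrow> real) \<Rightarrow> (real \<Rightarrow> real) \<Rightarrow> bool" where
  "A0_closure_graph f0 w g \<longleftrightarrow> L2rho w \<and> L2rho g \<and>
     (\<exists>\<phi> :: nat \<Rightarrow> real \<Rightarrow> real. (\<forall>n. test_fun (\<phi> n)) \<and>
        (\<lambda>n. L2rho_norm2 (\<lambda>y. \<phi> n y - w y)) \<longlonglongrightarrow> 0 \<and>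
        (\<lambda>n. L2rho_norm2 (\<lambda>y. A0 f0 (\<phi> n) y - g y)) \<longlonglongrightarrow> 0)"

definition A0_eigenvalue :: "(real \<Rightarrow> real) \<Rightarrow> real \<Rightarrow> bool" where
  "A0_eigenvalue f0 lam \<longleftrightarrow>
     (\<exists>w. \<not> (AE y in lborel. y > 0 \<longrightarrow> w y = 0) \<and>
          A0_closure_graph f0 w (\<lambda>y. lam * w y))"

end

theory Submission
  imports Defs
begin

text \<open>
  Shifting the blow-up time produces the mode \<open>y f\<^sub>0'(y)\<close>, for which differentiating the profile
  equation gives the eigenvalue \<open>-1\<close>; cutting it off near \<open>0\<close> and \<open>\<infinity>\<close> puts it into the domain of the
  closure. Conversely, the potential \<open>2 cos (2 f\<^sub>0) / y\<^sup>2\<close> is so close to that of \<open>f0_approx\<close> that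
  the form of the operator is at least \<open>1/200\<close> times the square norm on test functions vanishing at the
  single point \<open>y = sqrt (3/10)\<close>: on each of three intervals there is an explicit rational \<open>g\<close> such
  that \<open>\<phi>' - g \<phi>\<close> completes the square (a positive supersolution \<open>u\<close> with \<open>g = u'/u\<close>), \<open>g\<close> jumps
  down where the first two intervals meet, and the boundary terms at \<open>sqrt (3/10)\<close> vanish. Since
  only one linear condition is imposed, the space of eigenvectors with eigenvalues in
  \<open>(-\<infinity>, 0]\<close> has dimension at most one.
\<close>

section \<open>Bounds on the potential\<close>

text \<open>Elements of the closure are only limits in the weighted space, so evaluating them at a
  point has no meaning. The point condition is therefore imposed on the approximating test
  functions, with coefficients that depend on the index, and only inner products are passed to the
  limit. Unlike orthogonality to the mode, a point condition cuts the half-line into two Dirichlet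
  problems, whose positivity can be certified by rational functions without knowledge of
  \<open>f0'\<close>. The gap \<open>1/200\<close> is what remains of \<open>3/100\<close> after
  \<open>1/40\<close> has been spent on replacing \<open>f0\<close> by \<open>f0_approx\<close>;
  being strictly positive, it excludes the eigenvalue 0 as well. Of the norm hypothesis, the
  \<open>p1\<close> part controls the potential, while the \<open>p3\<close> part keeps
  \<open>f0'\<close> bounded, which puts the mode into the weighted space.\<close>

lemma cheb_T_cos: "cheb_T n (cos t) = cos (real n * t)"
proof (induction n rule: induct_nat_012)
  case (ge2 n)
  have "cos (real (Suc (Suc n)) * t) + cos (real n * t) = 2 * cos t * cos (real (Suc n) * t)"
    using cos_plus_cos[of "real (Suc (Suc n)) * t" "real n * t"] by (simp add: algebra_simps add_divide_distrib)
  with ge2 show ?case by simp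
qed auto

lemma abs_cos_odd_multiple_le: "\<bar>cos (real (2*n+1) * t)\<bar> \<le> real (2*n+1) * \<bar>cos t\<bar>"
proof (induction n)
  case (Suc n)
  let ?m = "real (2*n+1) * t"
  have "cos (real (2 * Suc n + 1) * t) = cos (?m + 2 * t)"
    by (simp add: algebra_simps)
  also have "\<dots> = cos ?m * cos (2*t) - sin ?m * (2 * sin t * cos t)"
    by (simp only: cos_add sin_double)
  finally have "\<bar>cos (real (2 * Suc n + 1) * t)\<bar> \<le> \<bar>cos ?m\<bar> * \<bar>cos (2*t)\<bar> + \<bar>sin ?m\<bar> * \<bar>2 * sin t * cos t\<bar>"
    by (simp only: abs_mult[symmetric] abs_triangle_ineq4)
  also have "\<dots> \<le> \<bar>cos ?m\<bar> * 1 + 1 * \<bar>2 * sin t * cos t\<bar>"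
    by (intro add_mono mult_mono) auto
  also have "\<dots> \<le> real (2*n+1) * \<bar>cos t\<bar> + 2 * (1 * \<bar>cos t\<bar>)"
    using Suc mult_right_mono[OF abs_sin_le_one[of t], of "\<bar>cos t\<bar>"] by (simp add: abs_mult)
  finally show ?case by (simp add: algebra_simps)
qed simp

text \<open>A bound proportional to \<open>x\<close>, in place of the plain bound 1, lets the tail
  of the Chebyshev sum be absorbed into the slope of a linear bound that is good near the origin
  too.\<close>

lemma abs_cheb_T_odd_le:
  assumes "\<bar>x\<bar> \<le> 1"
  shows "\<bar>cheb_T (2*n+1) x\<bar> \<le> real (2*n+1) * \<bar>x\<bar>"
  using abs_cos_odd_multiple_le[of n "arccos x"] cheb_T_cos[of "2*n+1" "arccos x"] assms
  by (simp add: cos_arccos_abs)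

definition cheb_sum :: "real \<Rightarrow> real" where
  "cheb_sum x = (\<Sum>n<15. (f0_coeffs ! n) * cheb_T (2*n+1) x)"

text \<open>The first three terms divided by \<open>x\<close> form an explicit quadratic in
  \<open>x^2\<close>; the other twelve contribute at most \<open>89/10000 * x\<close>. The third
  bound is meant for \<open>y^2\<close> up to \<open>3/10\<close>, where
  \<open>x^2 = y^2 / (2 + y^2)\<close> is at most \<open>3/23\<close>, which is below
  \<open>131/1000\<close>.\<close>

lemma cheb_sum_bounds:
  assumes "0 \<le> x" "x \<le> 1"
  shows "cheb_sum x \<ge> 365/100 * x" "cheb_sum x \<le> 388/100 * x"
    and "x^2 \<le> 131/1000 \<Longrightarrow> cheb_sum x \<ge> 378/100 * x"
proof -
  define c where "c n = f0_coeffs ! n" for n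
  have c: "c 0 = 268245/72878" "c 1 = -3174/105551" "c (Suc 0) = -3174/105551" "c 2 = 1897/97022"
    by (simp_all add: c_def f0_coeffs_def)
  define r where "r = (\<Sum>n\<in>{3..<15}. c n * cheb_T (2*n+1) x)"
  have "{..<15::nat} = {0,1,2} \<union> {3..<15}" by auto
  then have "cheb_sum x = (\<Sum>n\<in>{0,1,2}. c n * cheb_T (2*n+1) x) + r"
    unfolding cheb_sum_def r_def c_def by (simp add: sum.union_disjoint)
  also have "(\<Sum>n\<in>{0,1,2}. c n * cheb_T (2*n+1) x)
      = x * (c 0 + c 1 * (4*x^2-3) + c 2 * (16*(x^2)^2 - 20*x^2 + 5))"
    by (simp add: eval_nat_numeral algebra_simps)
  finally have S: "cheb_sum x = x * (c 0 + c 1 * (4*x^2-3) + c 2 * (16*(x^2)^2 - 20*x^2 + 5)) + r" .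
  have "\<bar>r\<bar> \<le> (\<Sum>n\<in>{3..<15}. \<bar>c n\<bar> * (real (2*n+1) * \<bar>x\<bar>))"
    unfolding r_def using abs_cheb_T_odd_le[of x] assms
    by (intro order_trans[OF sum_abs] sum_mono) (auto simp: abs_mult intro!: mult_left_mono)
  also have "\<dots> = (\<Sum>n\<in>{3..<15}. \<bar>c n\<bar> * real (2*n+1)) * x"
    using assms by (simp add: sum_distrib_right mult.assoc)
  also have "(\<Sum>n\<in>{3..<15}. \<bar>c n\<bar> * real (2*n+1)) \<le> 89/10000"
  proof -
    have "{3..<15} = {3,4,5,6,7,8,9,10,11,12,13,14::nat}"
      unfolding set_eq_iff by (simp, presburger)
    then show ?thesis by (simp add: c_def f0_coeffs_def)
  qed
  finally have r: "\<bar>r\<bar> \<le> 89/10000 * x" using assms by (simp add: mult_right_mono)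
  define X where "X = x^2"
  have X: "0 \<le> X" "X \<le> 1" using assms by (auto simp: X_def power_le_one)
  define q where "q = c 0 + c 1 * (4*X-3) + c 2 * (16*X^2 - 20*X + 5)"
  have S': "cheb_sum x = x * q + r" using S by (simp add: q_def X_def)
  define A B C where "A = c 0 - 3 * c 1 + 5 * c 2" and "B = 4 * c 1 - 20 * c 2" and "C = 16 * c 2"
  have q: "q = A + B * X + C * X^2"
    by (simp add: q_def A_def B_def C_def algebra_simps)
  have ABC: "A \<ge> 38687/10000" "A \<le> 38688/10000" "B \<ge> -51133/100000" "B \<le> - 51/100"
      "C \<ge> 3128/10000" "C \<le> 3129/10000"
    unfolding A_def B_def C_def c by simp_all
  have XX: "0 \<le> X^2" "X^2 \<le> X" using X by (auto simp: power2_eq_square mult_left_le)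
  have BC: "B * X \<ge> -51133/100000 * X" "B * X \<le> - 51/100 * X" "C * X^2 \<ge> 3128/10000 * X^2"
      "C * X^2 \<le> 3129/10000 * X^2"
    by (rule mult_right_mono, use ABC X XX in linarith, use X XX in linarith)+
  \<comment> \<open>Tangent to \<open>X^2\<close> at the approximate minimiser
    \<open>- B / (2 * C)\<close> of the quadratic: the lower bound for \<open>q\<close> becomes
    linear with slope almost 0.\<close>
  have "0 \<le> (X - 8173/10000)^2" by simp
  then have "X^2 \<ge> 16346/10000 * X - (8173/10000)^2" by (simp add: power2_eq_square algebra_simps)
  then have "X^2 \<ge> 16346/10000 * X - 66798/100000" by (simp add: power2_eq_square)
  then have "q \<ge> 36595/10000" using q ABC BC X by linarith
  then have 1: "x * q \<ge> x * (36595/10000)" using assms by (intro mult_left_mono) auto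
  have "q \<le> 3869/1000" using q ABC BC XX X by linarith
  then have 2: "x * q \<le> x * (3869/1000)" using assms by (intro mult_left_mono) auto
  show "cheb_sum x \<ge> 365/100 * x" using S' r 1 assms by (auto simp: abs_le_iff)
  show "cheb_sum x \<le> 388/100 * x" using S' r 2 assms by (auto simp: abs_le_iff)
  assume "x^2 \<le> 131/1000"
  then have "q \<ge> 38/10" using q ABC BC XX unfolding X_def[symmetric] by linarith
  then have 3: "x * q \<ge> x * (38/10)" using assms by (intro mult_left_mono) auto
  show "cheb_sum x \<ge> 378/100 * x" using S' r 3 assms by (auto simp: abs_le_iff)
qed

section \<open>The potential in terms of the squared tangent of half the profile\<close>

lemma cos_4_arctan: "cos (2 * (2 * arctan p)) = 1 - 8 * p^2 / (1 + p^2)^2"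
proof -
  have pos: "1 + p^2 > 0" by (smt (verit) zero_le_power2)
  have "cos (2 * arctan p) = 2 * (1 / sqrt (1 + p^2))^2 - 1"
    by (simp add: cos_double_cos cos_arctan)
  also have "\<dots> = (1 - p^2) / (1 + p^2)"
    using pos by (simp add: power_divide field_simps)
  finally have "cos (2 * (2 * arctan p)) = 2 * ((1 - p^2) / (1 + p^2))^2 - 1"
    using cos_double_cos[of "2 * arctan p"] by simp
  also have "((1 - p^2) / (1 + p^2))^2 = ((1 + p^2)^2 - 4 * p^2) / (1 + p^2)^2"
    unfolding power_divide by (simp add: power2_eq_square algebra_simps)
  also have "\<dots> = 1 - 4 * p^2 / (1 + p^2)^2"
    using pos by (simp add: diff_divide_distrib)
  finally show ?thesis by simp
qed

text \<open>Both factors matter: \<open>f0\<close> and \<open>f0_approx\<close> are each of order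
  \<open>y\<close> at the origin, so the product is of order \<open>y^2\<close> and survives the
  division by \<open>y^2\<close> in the potential. A Lipschitz bound alone would lose one
  order.\<close>

lemma cos_double_diff_le: "\<bar>cos (2*a) - cos (2*b)\<bar> \<le> 2 * \<bar>a + b\<bar> * \<bar>a - b\<bar>" for a b :: real
proof -
  have "cos (2*a) - cos (2*b) = 2 * sin (a + b) * sin (b - a)"
    using cos_diff_cos[of "2*a" "2*b"] by (simp add: add_divide_distrib diff_divide_distrib)
  then have "\<bar>cos (2*a) - cos (2*b)\<bar> = 2 * (\<bar>sin (a + b)\<bar> * \<bar>sin (b - a)\<bar>)" by (simp add: abs_mult)
  also have "\<dots> \<le> 2 * (\<bar>a + b\<bar> * \<bar>b - a\<bar>)"
    by (intro mult_left_mono mult_mono abs_sin_x_le_abs_x) auto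
  finally show ?thesis by (simp add: abs_minus_commute)
qed

text \<open>The witness is \<open>t = p^2\<close> with \<open>f0_approx y = 2 * arctan p\<close>.
  Its brackets are the squared slopes \<open>365/100\<close>, \<open>388/100\<close> and
  \<open>378/100\<close> of \<open>cheb_sum\<close>, rounded, times
  \<open>x^2 = y^2 / (2 + y^2)\<close>. The term \<open>y^2 / 40\<close> pays for the distance from
  \<open>f\<close> to \<open>f0_approx y\<close>.\<close>

lemma potential_lower_bound:
  assumes y: "y > 0" and close: "\<bar>p1 y * (f - f0_approx y)\<bar> \<le> 5/10000"
  obtains t where "2 * cos (2 * f) \<ge> 2 - 16 * t / (1 + t)^2 - y^2 / 40"
    "t \<ge> 133/10 * y^2 / (2 + y^2)" "t \<le> 151/10 * y^2 / (2 + y^2)"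
    "y^2 \<le> 3/10 \<Longrightarrow> t \<ge> 142/10 * y^2 / (2 + y^2)"
proof -
  define s where "s = sqrt (2 + y^2)"
  have s: "s > 0" "s^2 = 2 + y^2" by (auto simp: s_def add_pos_nonneg)
  define x where "x = y / s"
  have xx: "x^2 = y^2 / (2 + y^2)" by (simp add: x_def power_divide s)
  have x: "x > 0" using y s by (simp add: x_def)
  have "x^2 \<le> 1" by (simp add: xx add_pos_nonneg)
  then have x1: "x \<le> 1" by (simp add: abs_square_le_1)
  define p where "p = cheb_sum x"
  have p: "p \<ge> 365/100 * x" "p \<le> 388/100 * x" "x^2 \<le> 131/1000 \<Longrightarrow> p \<ge> 378/100 * x"
    using cheb_sum_bounds[of x] x x1 by (auto simp: p_def)
  have fa: "f0_approx y = 2 * arctan p" by (simp add: f0_approx_def p_def cheb_sum_def x_def s_def)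
  have p0: "p > 0" using p x by linarith
  have at: "0 < arctan p" "arctan p \<le> p" using p0 arctan_le_self[of p] by auto
  have "p1 y = s / (sqrt 2 * y)" by (simp add: p1_def s_def)
  then have "s / (sqrt 2 * y) * \<bar>f - f0_approx y\<bar> \<le> 5/10000"
    using close s y by (simp add: abs_mult)
  then have "\<bar>f - f0_approx y\<bar> \<le> 5/10000 * (sqrt 2 * x)"
    using s y by (simp add: field_simps x_def)
  also have "sqrt 2 \<le> 142/100" by (rule real_le_lsqrt) (auto simp: power2_eq_square)
  finally have d: "\<bar>f - f0_approx y\<bar> \<le> 71/100000 * x" using x by simp
  have "\<bar>f + f0_approx y\<bar> \<le> 2 * \<bar>f0_approx y\<bar> + \<bar>f - f0_approx y\<bar>" by linarith
  also have "\<dots> \<le> 156/10 * x" using d fa at p x by simp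
  finally have d2: "\<bar>f + f0_approx y\<bar> \<le> 156/10 * x" .
  have "\<bar>cos (2*f) - cos (2 * f0_approx y)\<bar> \<le> 2 * (\<bar>f + f0_approx y\<bar> * \<bar>f - f0_approx y\<bar>)"
    using cos_double_diff_le[of f "f0_approx y"] by simp
  also have "\<dots> \<le> 2 * (156/10 * x * (71/100000 * x))"
    using d d2 x by (intro mult_left_mono mult_mono) auto
  also have "\<dots> \<le> 1/40 * x^2" using x by (simp add: power2_eq_square)
  also have "x^2 \<le> y^2 / 2" unfolding xx by (intro divide_left_mono) (auto simp: add_pos_nonneg)
  finally have e: "\<bar>cos (2*f) - cos (2 * f0_approx y)\<bar> \<le> y^2 / 80" by simp
  define t where "t = p^2"
  have cf: "cos (2 * f0_approx y) = 1 - 8 * t / (1 + t)^2"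
    unfolding fa t_def by (rule cos_4_arctan)
  then have g1: "2 * cos (2 * f) \<ge> 2 - 16 * t / (1 + t)^2 - y^2 / 40"
  proof -
    have "16 * t / (1 + t)^2 = 2 * (8 * t / (1 + t)^2)" by simp
    with e cf show ?thesis by linarith
  qed
  have sq: "k^2 * x^2 \<le> t" if "p \<ge> k * x" "k \<ge> 0" for k
    unfolding t_def power_mult_distrib[symmetric] using that x by (intro power_mono) auto
  have "133/10 * x^2 \<le> (365/100)^2 * x^2" by (intro mult_right_mono) (auto simp: power2_eq_square)
  also have "\<dots> \<le> t" using sq[of "365/100"] p by simp
  finally have g2: "t \<ge> 133/10 * y^2 / (2 + y^2)" by (simp add: xx)
  have "t \<le> (388/100 * x)^2" unfolding t_def using p p0 by (intro power_mono) auto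
  also have "\<dots> \<le> 151/10 * x^2" by (simp add: power2_eq_square)
  finally have g3: "t \<le> 151/10 * y^2 / (2 + y^2)" by (simp add: xx)
  have g4: "t \<ge> 142/10 * y^2 / (2 + y^2)" if "y^2 \<le> 3/10"
  proof -
    have "2 + y^2 > 0" by (simp add: add_pos_nonneg)
    then have "x^2 \<le> 131/1000" unfolding xx using that by (simp add: field_simps)
    then have "(378/100)^2 * x^2 \<le> t" using p sq[of "378/100"] by simp
    moreover have "142/10 * x^2 \<le> (378/100)^2 * x^2" by (intro mult_right_mono) (auto simp: power2_eq_square)
    ultimately show ?thesis by (simp add: xx)
  qed
  show thesis using that g1 g2 g3 g4 by blast
qed

text \<open>The function \<open>t / (1 + t)^2\<close> is invariant under \<open>t\<close> to
  \<open>1/t\<close> and peaks at 1. For positive \<open>s\<close> and \<open>t\<close> the sign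
  condition says that \<open>t\<close> is at least as far from 1 as \<open>s\<close> on the
  logarithmic scale.\<close>

lemma div_one_plus_sq_le:
  fixes s t :: real
  assumes "0 \<le> t" "0 \<le> s" "(t - s) * (1 - s * t) \<le> 0"
  shows "t / (1 + t)^2 \<le> s / (1 + s)^2"
proof -
  have "t * (1 + s)^2 - s * (1 + t)^2 = (t - s) * (1 - s * t)"
    by (simp add: power2_eq_square algebra_simps)
  then have "t * (1 + s)^2 \<le> s * (1 + t)^2" using assms by linarith
  moreover have "1 + s > 0" "1 + t > 0" using assms by auto
  ultimately show ?thesis by (simp add: field_simps)
qed

text \<open>Replaces the unknown \<open>t\<close> by \<open>k * z / (2 + z)\<close>. Left of the
  peak at 1 this takes an upper bound for \<open>t\<close>, right of it a lower bound;
  \<open>k * z\<close> against \<open>2 + z\<close> tells on which side the replacement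
  lies.\<close>

lemma potential_le_of_parameter:
  fixes k t z :: real
  assumes "z > 0" "k > 0" "t \<ge> 0"
    and "t \<le> k * z / (2 + z) \<and> k * z \<le> 2 + z \<or> k * z / (2 + z) \<le> t \<and> 2 + z \<le> k * z"
  shows "2 - 16 * t / (1 + t)^2 \<ge> 2 - 16 * k * z * (2 + z) / (2 + (1 + k) * z)^2"
proof -
  define s where "s = k * z / (2 + z)"
  have s: "s > 0" using assms by (simp add: s_def)
  have "(t - s) * (1 - s * t) \<le> 0"
  proof (cases "t \<le> s")
    case True
    have "k * z \<le> 2 + z \<longleftrightarrow> s \<le> 1" using assms(1) by (simp add: s_def)
    with True consider "s \<le> 1" | "t = s" using assms(4) by (auto simp: s_def[symmetric])
    then show ?thesis
    proof cases
      case 1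
      then have "s * t \<le> 1" using True s assms mult_mono[of s 1 t 1] by simp
      then show ?thesis using True by (intro mult_nonpos_nonneg) auto
    qed auto
  next
    case False
    then have "2 + z \<le> k * z" using assms(4) by (auto simp: s_def)
    then have "s \<ge> 1" using assms(1) by (simp add: s_def)
    moreover from this have "t \<ge> 1" using False by simp
    ultimately have "s * t \<ge> 1" using mult_mono[of 1 s 1 t] by simp
    then show ?thesis using False by (intro mult_nonneg_nonpos) auto
  qed
  then have "t / (1 + t)^2 \<le> s / (1 + s)^2" using s assms by (intro div_one_plus_sq_le) auto
  also have "1 + s = (2 + (1 + k) * z) / (2 + z)" using assms by (simp add: s_def field_simps)
  also have "s / ((2 + (1 + k) * z) / (2 + z))^2 = k * z * (2 + z) / (2 + (1 + k) * z)^2"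
    using assms by (simp add: s_def power_divide power2_eq_square)
  finally show ?thesis by simp
qed

text \<open>The value at \<open>t = 1\<close> is the minimum. It serves where the brackets for
  \<open>t\<close> do not decide on which side of 1 it lies.\<close>

lemma potential_ge_minus_2:
  fixes t :: real
  assumes "t \<ge> 0"
  shows "2 - 16 * t / (1 + t)^2 \<ge> -2"
proof -
  have "0 \<le> (1 - t)^2" by simp
  then have "4 * t \<le> (1 + t)^2" by (simp add: power2_eq_square algebra_simps)
  moreover have "1 + t > 0" using assms by simp
  ultimately have "4 * t / (1 + t)^2 \<le> 1" by simp
  then show ?thesis by simp
qed

section \<open>Riccati inequalities for the three rational logarithmic derivatives\<close>

lemma quotient_le_2_minus:
  fixes a b d e :: real
  assumes "d > 0" "e > 0" "2 * (d^2 * e^2) - b * d^2 - a * e^2 \<ge> 0"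
  shows "a / d^2 \<le> 2 - b / e^2"
  using assms by (simp add: field_simps)

text \<open>With \<open>z = y\<^sup>2\<close> and \<open>g y = G z / y\<close> the following inequalities are the Riccati form
  \<open>g' + g\<^sup>2 + (2/y - y/2) g + 3/100 \<le> V\<close> of \<open>A\<^sub>0 u \<ge> (3/100) u\<close>, where \<open>u' = g u\<close>, \<open>V\<close> is the potential of
  \<open>f0_approx\<close> and \<open>t\<close> is the squared tangent of \<open>f0_approx y / 2\<close>. After clearing denominators, the
  differences are expanded in Bernstein bases, or in powers of \<open>z - 1\<close> on the unbounded interval.\<close>

lemma riccati_near_0:
  fixes z t :: real
  defines "G \<equiv> (1 - 35/2 * z) / (1 + 7 * z)"
  assumes z: "0 < z" "z \<le> 1/10" and t: "0 \<le> t" "t \<le> 151/10 * z / (2 + z)"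
  shows "2 * z * (- (49/2) / (1 + 7 * z)^2) + G^2 + G - z * G / 2 + 3/100 * z \<le> 2 - 16 * t / (1 + t)^2"
proof -
  \<comment> \<open>The value \<open>G 0 = 1\<close> belongs to a supersolution behaving like
    \<open>y\<close>, the regular behaviour for the potential \<open>2 / y^2\<close> at the origin.
    Both sides of the claim then equal 2 at \<open>z = 0\<close>, which is why a factor
    \<open>z\<close> splits off below.\<close>
  define n d e where "n = 1 - 35/2 * z" and "d = 1 + 7 * z" and "e = 2 + (1 + 151/10) * z"
  have pos: "d > 0" "e > 0" using z by (auto simp: d_def e_def)
  have "2 * z * (- (49/2) / d^2) + (n/d)^2 + n/d - z * (n/d) / 2 + 3/100 * z
      = (- 49 * z + n^2 + n * d - z * n * d / 2 + 3/100 * z * d^2) / d^2"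
    using pos by (simp add: field_simps power2_eq_square)
  also have "\<dots> \<le> 2 - 16 * (151/10) * z * (2 + z) / e^2"
  proof (rule quotient_le_2_minus[OF pos])
    have "2 * (d^2 * e^2) - 16 * (151/10) * z * (2 + z) * d^2
        - (- 49 * z + n^2 + n * d - z * n * d / 2 + 3/100 * z * d^2) * e^2
      = z * (86800 * (1/10 - z)^4
      + 894388 * z * (1/10 - z)^3
      + 203011657/100 * z^2 * (1/10 - z)^2
      + 664261839/500 * z^3 * (1/10 - z)
      + 112171821/1250 * z^4)"
      unfolding n_def d_def e_def by (simp add: field_simps eval_nat_numeral)
    also have "\<dots> \<ge> 0" using z by (intro mult_nonneg_nonneg add_nonneg_nonneg zero_le_power) auto
    finally show "2 * (d^2 * e^2) - 16 * (151/10) * z * (2 + z) * d^2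
        - (- 49 * z + n^2 + n * d - z * n * d / 2 + 3/100 * z * d^2) * e^2 \<ge> 0" .
  qed
  also have "\<dots> \<le> 2 - 16 * t / (1 + t)^2"
    unfolding e_def using z t by (intro potential_le_of_parameter) auto
  finally show ?thesis unfolding G_def n_def d_def .
qed

lemma riccati_middle:
  fixes z t :: real
  defines "G \<equiv> 3/10 - 17/2 * z"
  assumes z: "1/10 \<le> z" "z \<le> 3/10" and t: "142/10 * z / (2 + z) \<le> t" "t \<le> 151/10 * z / (2 + z)"
  shows "2 * z * (- (17/2)) + G^2 + G - z * G / 2 + 3/100 * z \<le> 2 - 16 * t / (1 + t)^2"
proof -
  have t0: "t \<ge> 0" using z by (intro order_trans[OF _ t(1)]) auto
  have *: ?thesis 
    if "k > 0" "2 * (2 + (1 + k) * z)^2 - 16 * k * z * (2 + z)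
        - (2 * z * (- (17/2)) + G^2 + G - z * G / 2 + 3/100 * z) * (2 + (1 + k) * z)^2 \<ge> 0"
      "t \<le> k * z / (2 + z) \<and> k * z \<le> 2 + z \<or> k * z / (2 + z) \<le> t \<and> 2 + z \<le> k * z" for k
  proof -
    have "2 + (1 + k) * z > 0" using that z by (simp add: add_pos_nonneg)
    then have "2 * z * (- (17/2)) + G^2 + G - z * G / 2 + 3/100 * z \<le> 2 - 16 * k * z * (2 + z) / (2 + (1 + k) * z)^2"
      using quotient_le_2_minus[of 1 "2 + (1 + k) * z" "16 * k * z * (2 + z)" "2 * z * (- (17/2)) + G^2 + G - z * G / 2 + 3/100 * z"]
        that(2) by simp
    also have "\<dots> \<le> 2 - 16 * t / (1 + t)^2" using that z t0 by (intro potential_le_of_parameter) auto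
    finally show ?thesis .
  qed
  \<comment> \<open>The brackets give \<open>t\<close> at most 1 up to \<open>z = 2/14.1\<close>,
    about 0.142, and at least 1 from \<open>z = 2/13.2\<close>, about 0.152. The middle case covers
    the gap with the crude value -2.\<close>
  consider "z \<le> 13/100" | "13/100 \<le> z" "z \<le> 17/100" | "17/100 \<le> z" by linarith
  then show ?thesis
  proof cases
    case 1
    have "2 * (2 + (1 + 151/10) * z)^2 - 16 * (151/10) * z * (2 + z)
        - (2 * z * (- (17/2)) + G^2 + G - z * G / 2 + 3/100 * z) * (2 + (1 + 151/10) * z)^2
      = 31073570/81 * (13/100 - z)^4
      + 498558968/81 * (z - 1/10) * (13/100 - z)^3
      + 2417442374/135 * (z - 1/10)^2 * (13/100 - z)^2
      + 37908259721/2025 * (z - 1/10)^3 * (13/100 - z)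
      + 21269766707/3240 * (z - 1/10)^4"
      unfolding G_def by (simp add: field_simps eval_nat_numeral)
    also have "\<dots> \<ge> 0" using z 1 by (intro mult_nonneg_nonneg add_nonneg_nonneg zero_le_power) auto
    finally show ?thesis using 1 z t by (intro *[of "151/10"]) auto
  next
    case 2
    have "- 2 - (2 * z * (- (17/2)) + G^2 + G - z * G / 2 + 3/100 * z)
      = 6215/32 * (17/100 - z)^2
      + 10547/16 * (z - 13/100) * (17/100 - z)
      + 12431/32 * (z - 13/100)^2"
      unfolding G_def by (simp add: field_simps power2_eq_square)
    also have "\<dots> \<ge> 0" using z 2 by (intro mult_nonneg_nonneg add_nonneg_nonneg zero_le_power) auto
    finally show ?thesis using potential_ge_minus_2[OF t0] by linarith
  next
    case 3
    have "2 * (2 + (1 + 142/10) * z)^2 - 16 * (142/10) * z * (2 + z)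
        - (2 * z * (- (17/2)) + G^2 + G - z * G / 2 + 3/100 * z) * (2 + (1 + 142/10) * z)^2
      = 33247022392/714025 * (3/10 - z)^4
      + 201677854816/714025 * (z - 17/100) * (3/10 - z)^3
      + 80175881504/142805 * (z - 17/100)^2 * (3/10 - z)^2
      + 11085487872/28561 * (z - 17/100)^3 * (3/10 - z)
      + 1282741760/28561 * (z - 17/100)^4"
      unfolding G_def by (simp add: field_simps eval_nat_numeral)
    also have "\<dots> \<ge> 0" using z 3 by (intro mult_nonneg_nonneg add_nonneg_nonneg zero_le_power) auto
    finally show ?thesis using 3 z t by (intro *[of "142/10"]) auto
  qed
qed

lemma riccati_outer:
  fixes z t :: real
  defines "G \<equiv> 1/10 + 17/100 / z^2"
  assumes z: "3/10 \<le> z" and t: "133/10 * z / (2 + z) \<le> t"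
  shows "2 * z * (- (34/100) / z^3) + G^2 + G - z * G / 2 + 3/100 * z \<le> 2 - 16 * t / (1 + t)^2"
proof -
  have t0: "t \<ge> 0" using z by (intro order_trans[OF _ t]) auto
  define e where "e = 2 + (1 + 133/10) * z"
  have pos: "z^2 > 0" "e > 0" "z > 0" using z by (auto simp: e_def)
  \<comment> \<open>For large \<open>z\<close> the dominant terms are
    \<open>- z * G / 2 + 3/100 * z\<close>, and the limit \<open>1/10\<close> of \<open>G\<close>
    makes their sum negative. At \<open>z = 3/10\<close> the value is unrelated to that of the
    middle piece: it jumps up from -9/4 to almost 2, which the zero of the test function
    permits.\<close>
  define n where "n = z^2 / 10 + 17/100"
  have G: "G = n / z^2" using pos by (simp add: n_def G_def field_simps)
  have "2 * z * (- (34/100) / z^3) + (n/z^2)^2 + n/z^2 - z * (n/z^2) / 2 + 3/100 * z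
      = (- (68/100) * z^2 + n^2 + n * z^2 - z * n * z^2 / 2 + 3/100 * z * (z^2)^2) / (z^2)^2"
    using pos by (simp add: field_simps power2_eq_square power3_eq_cube)
  also have "\<dots> \<le> 2 - 16 * (133/10) * z * (2 + z) / e^2"
  proof (rule quotient_le_2_minus[OF pos(1,2)])
    let ?p = "2 * ((z^2)^2 * e^2) - 16 * (133/10) * z * (2 + z) * (z^2)^2
        - (- (68/100) * z^2 + n^2 + n * z^2 - z * n * z^2 / 2 + 3/100 * z * (z^2)^2) * e^2"
    show "?p \<ge> 0"
    proof (cases "z \<le> 1")
      case True
      have "?p = 3029679283/4117715000 * (1 - z)^7
      + 6265205109/117649000 * (z - 3/10) * (1 - z)^6
      + 10027074941/23529800 * (z - 3/10)^2 * (1 - z)^5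
      + 2175566171/1680700 * (z - 3/10)^3 * (1 - z)^4
      + 1956417331/1176490 * (z - 3/10)^4 * (1 - z)^3
      + 877575773/1176490 * (z - 3/10)^5 * (1 - z)^2
      + 14884082/117649 * (z - 3/10)^6 * (1 - z)
      + 104415490/823543 * (z - 3/10)^7"
        unfolding n_def e_def by (simp add: field_simps eval_nat_numeral)
      also have "\<dots> \<ge> 0" using z True by (intro mult_nonneg_nonneg add_nonneg_nonneg zero_le_power) auto
      finally show ?thesis .
    next
      case False
      have "?p = 10441549/1000000
      + 5595713/62500 * (z - 1)
      + 445285079/1000000 * (z - 1)^2
      + 55302283/50000 * (z - 1)^3
      + 137520199/100000 * (z - 1)^4
      + 16696721/20000 * (z - 1)^5
      + 2034587/10000 * (z - 1)^6
      + 20449/5000 * (z - 1)^7"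
        unfolding n_def e_def by (simp add: field_simps eval_nat_numeral)
      also have "\<dots> \<ge> 0" using z False by (intro mult_nonneg_nonneg add_nonneg_nonneg zero_le_power) auto
      finally show ?thesis .
    qed
  qed
  also have "\<dots> \<le> 2 - 16 * t / (1 + t)^2"
    unfolding e_def using z t t0 by (intro potential_le_of_parameter) auto
  finally show ?thesis unfolding G .
qed

section \<open>Smooth functions and cutoffs\<close>

text \<open>The towers of \<open>test_fun\<close>, relative to a set of points: products with
  derivatives of \<open>f0\<close> can then be formed on the open half-line before they are extended
  by zero.\<close>

definition smooth_on :: "real set \<Rightarrow> (real \<Rightarrow> real) \<Rightarrow> bool" where
  "smooth_on S f \<longleftrightarrow> (\<exists>D. D 0 = f \<and> (\<forall>n. \<forall>x\<in>S. (D n has_real_derivative D (Suc n) x) (at x)))"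

text \<open>Choosing a derivative inside the class and iterating the choice yields the whole tower.
  Smoothness thus reduces to a class closed under one differentiation, and no formula for higher
  derivatives is needed.\<close>

lemma smooth_on_coinduct:
  assumes "f \<in> F" and step: "\<And>f. f \<in> F \<Longrightarrow> \<exists>f'\<in>F. \<forall>x\<in>S. (f has_real_derivative f' x) (at x)"
  shows "smooth_on S f"
proof -
  obtain d where d: "\<And>f. f \<in> F \<Longrightarrow> d f \<in> F" "\<And>f x. f \<in> F \<Longrightarrow> x \<in> S \<Longrightarrow> (f has_real_derivative d f x) (at x)"
    using step by metis
  have "(d ^^ n) f \<in> F" for n by (induction n) (auto simp: assms d)
  then show ?thesis
    unfolding smooth_on_def by (intro exI[of _ "\<lambda>n. (d ^^ n) f"]) (auto simp: d)
qed

lemma smooth_on_deriv: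
  assumes "smooth_on S f"
  obtains f' where "smooth_on S f'" "\<And>x. x \<in> S \<Longrightarrow> (f has_real_derivative f' x) (at x)"
proof -
  obtain D where D: "D 0 = f" "\<And>n x. x \<in> S \<Longrightarrow> (D n has_real_derivative D (Suc n) x) (at x)"
    using assms unfolding smooth_on_def by auto
  have "smooth_on S (D 1)"
    unfolding smooth_on_def using D by (intro exI[of _ "\<lambda>n. D (Suc n)"]) auto
  with D(1) D(2)[of _ 0] that show ?thesis by auto
qed

lemma smooth_on_UNIV_deriv:
  assumes "smooth_on UNIV f"
  shows "\<exists>f'. smooth_on UNIV f' \<and> (\<forall>x. (f has_real_derivative f' x) (at x))"
  using smooth_on_deriv[OF assms] by (metis UNIV_I)

lemma smooth_on_subset: "smooth_on S f \<Longrightarrow> T \<subseteq> S \<Longrightarrow> smooth_on T f"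
  unfolding smooth_on_def by blast

lemma smooth_on_continuous: "smooth_on S f \<Longrightarrow> continuous_on S f"
  by (meson DERIV_continuous continuous_at_imp_continuous_on smooth_on_deriv)

lemma smooth_on_const [intro]: "smooth_on S (\<lambda>x. c)"
  by (rule smooth_on_coinduct[where F = "range (\<lambda>c x. c)"]) (auto intro!: derivative_eq_intros)

lemma smooth_on_ident [intro]: "smooth_on S (\<lambda>x. x)"
  by (rule smooth_on_coinduct[where F = "insert (\<lambda>x. x) (range (\<lambda>c x. c))"]) (auto intro!: derivative_eq_intros)

text \<open>By the product rule, finite sums of products of smooth functions are closed under
  differentiation, whereas products alone are not. This is the class for the coinduction.\<close>

inductive_set products_on :: "real set \<Rightarrow> (real \<Rightarrow> real) set" for S where
  mult: "smooth_on S g \<Longrightarrow> smooth_on S h \<Longrightarrow> (\<lambda>x. g x * h x) \<in> products_on S"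
| add: "u \<in> products_on S \<Longrightarrow> v \<in> products_on S \<Longrightarrow> (\<lambda>x. u x + v x) \<in> products_on S"

lemma products_on_smooth: "f \<in> products_on S \<Longrightarrow> smooth_on S f"
proof (erule smooth_on_coinduct)
  fix f assume "f \<in> products_on S"
  then show "\<exists>f'\<in>products_on S. \<forall>x\<in>S. (f has_real_derivative f' x) (at x)"
  proof induction
    case (mult g h)
    obtain g' where g': "smooth_on S g'" "\<And>x. x \<in> S \<Longrightarrow> (g has_real_derivative g' x) (at x)"
      using mult smooth_on_deriv by blast
    obtain h' where h': "smooth_on S h'" "\<And>x. x \<in> S \<Longrightarrow> (h has_real_derivative h' x) (at x)"
      using mult smooth_on_deriv by blast
    show ?case
      using mult g' h'
      by (intro bexI[of _ "\<lambda>x. g' x * h x + h' x * g x"] products_on.intros)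
         (auto intro!: DERIV_mult)
  next
    case (add u v)
    then obtain u' v' where "u' \<in> products_on S" "\<forall>x\<in>S. (u has_real_derivative u' x) (at x)"
      "v' \<in> products_on S" "\<forall>x\<in>S. (v has_real_derivative v' x) (at x)" by blast
    then show ?case
      by (intro bexI[of _ "\<lambda>x. u' x + v' x"] products_on.intros) (auto intro!: DERIV_add)
  qed
qed

lemma smooth_on_mult: "smooth_on S f \<Longrightarrow> smooth_on S g \<Longrightarrow> smooth_on S (\<lambda>x. f x * g x)"
  by (rule products_on_smooth, rule products_on.mult)

lemma smooth_on_add: 
  assumes "smooth_on S f" "smooth_on S g" shows "smooth_on S (\<lambda>x. f x + g x)"
  using products_on_smooth[OF products_on.add[OF products_on.mult[OF assms(1) smooth_on_const[of _ 1]] 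
      products_on.mult[OF assms(2) smooth_on_const[of _ 1]]]] by simp

lemma smooth_on_scaled:
  assumes "smooth_on UNIV f" shows "smooth_on UNIV (\<lambda>x. f (a * x + b))"
proof -
  obtain D where D: "D 0 = f" "\<And>n x. (D n has_real_derivative D (Suc n) x) (at x)"
    using assms unfolding smooth_on_def by auto
  have "((\<lambda>x. a ^ n * D n (a * x + b)) has_real_derivative a ^ Suc n * D (Suc n) (a * x + b)) (at x)" for n x
    by (rule derivative_eq_intros DERIV_chain2[OF D(2)[of n]] refl | simp)+
  then show ?thesis
    unfolding smooth_on_def using D(1) by (intro exI[of _ "\<lambda>n x. a ^ n * D n (a * x + b)"]) auto
qed

text \<open>The given tower says nothing at nonpositive arguments, so it is replaced by 0 there. The
  two parts fit because every derivative already vanishes between 0 and \<open>a\<close>.\<close>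

lemma smooth_on_extend_zero:
  assumes f: "smooth_on {0<..} f" and a: "a > 0" and zero: "\<And>x. x < a \<Longrightarrow> f x = 0"
  shows "smooth_on UNIV f"
proof -
  obtain D where D: "D 0 = f" "\<And>n x. x > 0 \<Longrightarrow> (D n has_real_derivative D (Suc n) x) (at x)"
    using f unfolding smooth_on_def by auto
  have D0: "\<forall>x. 0 < x \<and> x < a \<longrightarrow> D n x = 0" for n
  proof (induction n)
    case (Suc n)
    show ?case
    proof safe
      fix x :: real assume x: "0 < x" "x < a"
      have "(D n has_real_derivative 0) (at x)"
        by (rule has_field_derivative_transform_within_open[of "\<lambda>_. 0" _ _ "{0<..<a}"]) (use x Suc in auto)
      with D(2)[OF x(1), of n] show "D (Suc n) x = 0" by (rule DERIV_unique)
    qed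
  qed (auto simp: D zero)
  define E where "E n x = (if x > 0 then D n x else 0)" for n x
  have "E 0 = f" using zero a by (auto simp: E_def D fun_eq_iff)
  moreover have "(E n has_real_derivative E (Suc n) x) (at x)" for n x
  proof (cases "x > 0")
    case True
    then have "(E n has_real_derivative D (Suc n) x) (at x)"
      by (intro has_field_derivative_transform_within_open[OF D(2), of _ "{0<..}"]) (auto simp: E_def)
    then show ?thesis using True by (simp add: E_def)
  next
    case False
    have "(E n has_real_derivative 0) (at x)"
      by (rule has_field_derivative_transform_within_open[of "\<lambda>_. 0" _ _ "{..<a}"])
         (use False D0 a in \<open>auto simp: E_def\<close>)
    then show ?thesis using False by (simp add: E_def)
  qed
  ultimately show ?thesis unfolding smooth_on_def by blast
qed

section \<open>Flat functions, a smooth step and the cutoffs\<close>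

lemma tendsto_poly_exp_minus: "((\<lambda>t::real. poly p t * exp (- t)) \<longlongrightarrow> 0) at_top"
proof -
  have "((\<lambda>t. \<Sum>i\<le>degree p. coeff p i * (t ^ i / exp t)) \<longlongrightarrow> (\<Sum>i\<le>degree p. coeff p i * 0)) at_top"
    by (intro tendsto_sum tendsto_mult tendsto_power_div_exp_0 tendsto_const)
  then show ?thesis
    by (simp add: poly_altdef sum_divide_distrib exp_minus field_simps)
qed

text \<open>The polynomial in \<open>1/x\<close> in front of \<open>exp (- 1/x)\<close> makes the
  family closed under differentiation: the polynomial \<open>p\<close> becomes
  \<open>X^2 * (p - p')\<close>, where \<open>X^2\<close>, written \<open>[:0,0,1:]\<close>, stands
  for \<open>1/x^2\<close>.\<close>

definition flat :: "real poly \<Rightarrow> real \<Rightarrow> real" where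
  "flat p x = (if x > 0 then poly p (1/x) * exp (- 1/x) else 0)"

lemma flat_has_derivative:
  "(flat p has_real_derivative flat ([:0,0,1:] * (p - pderiv p)) x) (at x)"
proof -
  consider "x > 0" | "x < 0" | "x = 0" by linarith
  then show ?thesis
  proof cases
    case 1
    have "((\<lambda>x. poly p (1/x) * exp (- 1/x)) has_real_derivative flat ([:0,0,1:] * (p - pderiv p)) x) (at x)"
      using 1 by (auto intro!: derivative_eq_intros poly_DERIV[THEN DERIV_chain2] 
         simp: flat_def algebra_simps power2_eq_square)
    then show ?thesis
      by (rule has_field_derivative_transform_within_open[of _ _ _ "{0<..}"]) (use 1 in \<open>auto simp: flat_def\<close>)
  next
    case 2
    have "(flat p has_real_derivative 0) (at x)"
      by (rule has_field_derivative_transform_within_open[of "\<lambda>_. 0" _ _ "{..<0}"]) (use 2 in \<open>auto simp: flat_def\<close>)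
    then show ?thesis using 2 by (simp add: flat_def)
  next
    case 3
    \<comment> \<open>The difference quotient at 0 divides by \<open>h\<close>, that is, it
      multiplies the polynomial in \<open>1/h\<close> by its variable; hence
      \<open>pCons 0 p\<close>.\<close>
    have "((\<lambda>h. poly (pCons 0 p) (inverse h) * exp (- inverse h)) \<longlongrightarrow> 0) (at_right 0)"
      by (rule filterlim_compose[OF tendsto_poly_exp_minus filterlim_inverse_at_top_right])
    then have "((\<lambda>h. flat p h / h) \<longlongrightarrow> 0) (at_right 0)"
      by (rule Lim_transform_eventually)
         (auto simp: eventually_at_filter flat_def divide_inverse mult_ac)
    moreover have "((\<lambda>h. flat p h / h) \<longlongrightarrow> 0) (at_left 0)"
      by (rule Lim_transform_eventually[OF tendsto_const])
         (auto simp: eventually_at_filter flat_def)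
    ultimately have "((\<lambda>h. flat p h / h) \<longlongrightarrow> 0) (at 0)" by (simp add: filterlim_at_split)
    then have "(flat p has_real_derivative 0) (at 0)"
      by (simp add: DERIV_def flat_def[of p 0])
    then show ?thesis using 3 by (simp add: flat_def)
  qed
qed

lemma smooth_on_flat: "smooth_on S (flat p)"
  by (rule smooth_on_coinduct[where F = "range flat"]) (use flat_has_derivative in auto)

lemma smooth_step_exists:
  "\<exists>s. smooth_on UNIV s \<and> (\<forall>x\<le>1. s x = 0) \<and> (\<forall>x\<ge>2. s x = 1)"
proof -
  define b where "b x = flat 1 (x - 1) * flat 1 (2 - x)" for x
  have "smooth_on UNIV (\<lambda>x. flat 1 (1 * x + (-1)) * flat 1 ((-1) * x + 2))"
    by (intro smooth_on_mult smooth_on_scaled smooth_on_flat)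
  then have smb: "smooth_on UNIV b" by (simp add: b_def[abs_def])
  then have cont: "continuous_on A b" for A
    using continuous_on_subset[OF smooth_on_continuous] by simp
  have b0: "b x = 0" if "x \<le> 1 \<or> x \<ge> 2" for x using that by (auto simp: b_def flat_def)
  have b_nonneg: "b x \<ge> 0" for x by (simp add: b_def flat_def)
  define B where "B x = integral {0..x} b" for x
  have B1: "B x = 0" if "x \<le> 1" for x
  proof -
    have "integral {0..x} b = integral {0..x} (\<lambda>_. 0)" using that b0 by (intro integral_cong) auto
    then show ?thesis by (simp add: B_def)
  qed
  have B2: "B x = B 2" if "x \<ge> 2" for x
  proof -
    have "integral {2..x} b = integral {2..x} (\<lambda>_. 0)" using b0 by (intro integral_cong) auto
    moreover have "B x = B 2 + integral {2..x} b"
      unfolding B_def using that cont by (intro Henstock_Kurzweil_Integration.integral_combine[symmetric] integrable_continuous_interval) auto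
    ultimately show ?thesis by simp
  qed
  have "B 2 \<noteq> 0"
  proof
    assume "B 2 = 0"
    have "integral {0..2} b = 0 \<longleftrightarrow> (\<forall>x\<in>{0..2}. b x = 0)"
      by (rule integral_eq_0_iff) (use cont b_nonneg in simp_all)
    with \<open>B 2 = 0\<close> have "\<forall>x\<in>{0..2}. b x = 0" by (simp add: B_def)
    then have "b (3/2) = 0" by auto
    moreover have "b (3/2) > 0" by (simp add: b_def flat_def)
    ultimately show False by simp
  qed
  have DB: "(B has_real_derivative b x) (at x)" for x
  proof (cases "x > 0")
    case True
    have "((\<lambda>u. integral {0..u} b) has_real_derivative b x) (at x within {0..x+1})"
      by (rule integral_has_real_derivative[OF cont]) (use True in simp)
    then have "(B has_real_derivative b x) (at x within {0..x+1})"
      by (simp add: B_def[abs_def])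
    moreover have "at x within {0..x+1} = at x"
      by (rule at_within_interior) (use True in auto)
    ultimately show ?thesis by simp
  next
    case False
    have "(B has_real_derivative 0) (at x)"
      by (rule has_field_derivative_transform_within_open[of "\<lambda>_. 0" _ _ "{..<1}"]) (use False B1 in auto)
    then show ?thesis using False b0 by simp
  qed
  have "smooth_on UNIV B"
  \<comment> \<open>Only the derivative \<open>b\<close> of \<open>B\<close> is known to be smooth,
    so \<open>B\<close> itself is adjoined to the class of smooth functions.\<close>
  proof (rule smooth_on_coinduct[where F = "insert B {f. smooth_on UNIV f}"])
    fix f assume "f \<in> insert B {f. smooth_on UNIV f}"
    then consider "f = B" | "smooth_on UNIV f" by blast
    then show "\<exists>f'\<in>insert B {f. smooth_on UNIV f}. \<forall>x\<in>UNIV. (f has_real_derivative f' x) (at x)"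
    proof cases
      case 1
      then show ?thesis using DB smb by (intro bexI[of _ b]) auto
    next
      case 2
      then show ?thesis using smooth_on_UNIV_deriv[OF 2] by blast
    qed
  qed simp
  then have "smooth_on UNIV (\<lambda>x. B x * (1 / B 2))"
    by (intro smooth_on_mult smooth_on_const)
  then show ?thesis
  proof (intro exI conjI allI impI)
    fix x :: real
    show "B x * (1 / B 2) = 0" if "x \<le> 1" unfolding B1[OF that] by simp
    show "B x * (1 / B 2) = 1" if "x \<ge> 2" unfolding B2[OF that] using \<open>B 2 \<noteq> 0\<close> by simp
  qed
qed

lemma bounded_of_compact_support:
  fixes f :: "real \<Rightarrow> real"
  assumes "continuous_on UNIV f" "\<And>x. x < a \<or> x > b \<Longrightarrow> \<bar>f x\<bar> \<le> c"
  shows "\<exists>K. \<forall>x. \<bar>f x\<bar> \<le> K"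
proof -
  have "bounded (f ` {a..b})"
    by (intro compact_imp_bounded compact_continuous_image continuous_on_subset[OF assms(1)]) auto
  then obtain K where K: "\<forall>v\<in>f ` {a..b}. norm v \<le> K" unfolding bounded_iff by blast
  have "\<bar>f x\<bar> \<le> max K c" for x
    using assms(2)[of x] K by (cases "x < a \<or> x > b") (auto simp: le_max_iff_disj not_less)
  then show ?thesis by blast
qed

text \<open>With \<open>N = n + 2\<close> the cutoff is 1 on \<open>[2/N, N]\<close> and vanishes
  outside \<open>[1/N, 2 * N]\<close>. The weights \<open>x\<close> and \<open>x^2\<close> on the
  derivatives are scale invariant: they turn into the arguments \<open>N * x\<close> and
  \<open>x / N\<close> of one fixed step function, so a single bound serves for all
  \<open>n\<close>.\<close>

lemma cutoff_functions:
  "\<exists>\<theta> \<theta>' \<theta>'' :: nat \<Rightarrow> real \<Rightarrow> real. \<exists>K. \<forall>n.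
    smooth_on UNIV (\<theta> n) \<and>
    (\<forall>x. (\<theta> n has_real_derivative \<theta>' n x) (at x)) \<and>
    (\<forall>x. (\<theta>' n has_real_derivative \<theta>'' n x) (at x)) \<and>
    (\<exists>a b. 0 < a \<and> a < b \<and> (\<forall>x. x \<notin> {a..b} \<longrightarrow> \<theta> n x = 0)) \<and>
    (\<forall>x. \<bar>\<theta> n x\<bar> \<le> K \<and> \<bar>x * \<theta>' n x\<bar> \<le> K \<and> \<bar>x^2 * \<theta>'' n x\<bar> \<le> K) \<and>
    (\<forall>x>0. \<forall>\<^sub>F n in sequentially. \<theta> n x = 1 \<and> \<theta>' n x = 0 \<and> \<theta>'' n x = 0)"
proof -
  obtain s where s: "smooth_on UNIV s" "\<forall>x\<le>1. s x = 0" "\<forall>x\<ge>2. s x = 1"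
    using smooth_step_exists by blast
  obtain s1 where s1: "smooth_on UNIV s1" "\<forall>x. (s has_real_derivative s1 x) (at x)"
    using smooth_on_UNIV_deriv[OF s(1)] by blast
  obtain s2 where s2: "smooth_on UNIV s2" "\<forall>x. (s1 has_real_derivative s2 x) (at x)"
    using smooth_on_UNIV_deriv[OF s1(1)] by blast
  have s1_0: "s1 x = 0" if "x < 1 \<or> x > 2" for x
  proof -
    have "(s has_real_derivative 0) (at x)"
      using that
    proof
      assume x: "x < 1"
      show ?thesis
        by (rule has_field_derivative_transform_within_open[of "\<lambda>_. 0" _ _ "{..<1}"]) (use s(2) x in auto)
    next
      assume x: "x > 2"
      show ?thesis
        by (rule has_field_derivative_transform_within_open[of "\<lambda>_. 1" _ _ "{2<..}"]) (use s(3) x in auto)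
    qed
    then show ?thesis using s1(2) DERIV_unique by blast
  qed
  have s2_0: "s2 x = 0" if "x < 1 \<or> x > 2" for x
  proof -
    have "(s1 has_real_derivative 0) (at x)"
      by (rule has_field_derivative_transform_within_open[of "\<lambda>_. 0" _ _ "- {1..2}"])
         (use that s1_0 in auto)
    then show ?thesis using s2(2) DERIV_unique by blast
  qed
  have cont: "continuous_on UNIV s" "continuous_on UNIV s1" "continuous_on UNIV s2"
    using s s1 s2 smooth_on_continuous by blast+
  have "\<exists>K. \<forall>x. \<bar>s x\<bar> \<le> K"
  proof (rule bounded_of_compact_support[OF cont(1), of 1 2 1])
    fix x :: real assume "x < 1 \<or> x > 2"
    then show "\<bar>s x\<bar> \<le> 1" using s(2)[rule_format, of x] s(3)[rule_format, of x] by auto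
  qed
  then obtain A where A: "\<And>x. \<bar>s x\<bar> \<le> A" by auto
  have "\<exists>K. \<forall>x. \<bar>x * s1 x\<bar> \<le> K"
    using s1_0 by (intro bounded_of_compact_support[of "\<lambda>x. x * s1 x" 1 2 0] continuous_intros cont) auto
  then obtain B where B: "\<And>x. \<bar>x * s1 x\<bar> \<le> B" by auto
  have "\<exists>K. \<forall>x. \<bar>x^2 * s2 x\<bar> \<le> K"
    using s2_0 by (intro bounded_of_compact_support[of "\<lambda>x. x^2 * s2 x" 1 2 0] continuous_intros cont) auto
  then obtain C where C: "\<And>x. \<bar>x^2 * s2 x\<bar> \<le> C" by auto
  define N where "N n = real n + 2" for n
  have N: "N n > 0" "N n \<ge> 2" for n by (auto simp: N_def)
  define r where "r n = 1 / N n" for n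
  define th where "th n x = s (N n * x) * (1 - s (r n * x))" for n x
  define th1 where "th1 n x = N n * s1 (N n * x) * (1 - s (r n * x)) - s (N n * x) * (r n * s1 (r n * x))" for n x
  define th2 where "th2 n x = (N n)^2 * s2 (N n * x) * (1 - s (r n * x)) - 2 * (N n * s1 (N n * x)) * (r n * s1 (r n * x))
     - s (N n * x) * ((r n)^2 * s2 (r n * x))" for n x
  have th_alt: "th n = (\<lambda>x. s (N n * x + 0) * (1 + (-1) * s (r n * x + 0)))" for n
    by (auto simp: th_def fun_eq_iff)
  show ?thesis
  proof (rule exI[of _ th], rule exI[of _ th1], rule exI[of _ th2],
      rule exI[of _ "A * (1 + A) + B * (1 + A) + A * B + C * (1 + A) + 2 * B * B + A * C"], safe)
    show "smooth_on UNIV (th n)" for n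
      unfolding th_alt by (intro smooth_on_mult smooth_on_add smooth_on_const smooth_on_scaled s)
    show "(th n has_real_derivative th1 n x) (at x)" for n x
      unfolding th_def th1_def
      by (auto intro!: derivative_eq_intros DERIV_chain2[OF s1(2)[rule_format]])
    show "(th1 n has_real_derivative th2 n x) (at x)" for n x
      unfolding th1_def th2_def
      by (auto intro!: derivative_eq_intros DERIV_chain2[OF s1(2)[rule_format]] DERIV_chain2[OF s2(2)[rule_format]]
        simp: power2_eq_square algebra_simps)
    show "\<exists>a b. 0 < a \<and> a < b \<and> (\<forall>x. x \<notin> {a..b} \<longrightarrow> th n x = 0)" for n
    proof (intro exI conjI allI impI)
      have "1 / N n < 2" "2 * N n \<ge> 2" using N[of n] by (auto simp: field_simps)
      then show "1 / N n < 2 * N n" by linarith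
      show "th n x = 0" if "x \<notin> {1 / N n..2 * N n}" for x
      proof -
        have "N n * x \<le> 1 \<or> r n * x \<ge> 2" using that N[of n] by (auto simp: field_simps r_def)
        then show ?thesis using s by (auto simp: th_def)
      qed
    qed (use N[of n] in auto)
    have pos: "A \<ge> 0" "B \<ge> 0" "C \<ge> 0" using A[of 0] B[of 0] C[of 0] by auto
    have 1: "\<bar>1 - s x\<bar> \<le> 1 + A" for x using A[of x] by linarith
    have m: "\<bar>u * v\<bar> \<le> U * V" if "\<bar>u\<bar> \<le> U" "\<bar>v\<bar> \<le> V" for u v U V :: real
      unfolding abs_mult using that by (intro mult_mono) auto
    have nn: "A * (1 + A) \<ge> 0" "B * (1 + A) \<ge> 0" "A * B \<ge> 0" "C * (1 + A) \<ge> 0" "B * B \<ge> 0" "A * C \<ge> 0"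
      using pos by auto
    show "\<bar>th n x\<bar> \<le> A * (1 + A) + B * (1 + A) + A * B + C * (1 + A) + 2 * B * B + A * C" for n x
      using m[OF A[of "N n * x"] 1[of "r n * x"]] nn unfolding th_def by linarith
    have e1: "x * th1 n x = (N n * x * s1 (N n * x)) * (1 - s (r n * x)) - s (N n * x) * (r n * x * s1 (r n * x))" for n x
      by (simp add: th1_def algebra_simps)
    show "\<bar>x * th1 n x\<bar> \<le> A * (1 + A) + B * (1 + A) + A * B + C * (1 + A) + 2 * B * B + A * C" for n x
      using e1[of x n] m[OF B[of "N n * x"] 1[of "r n * x"]] m[OF A[of "N n * x"] B[of "r n * x"]] nn by linarith
    have e2: "x^2 * th2 n x = ((N n * x)^2 * s2 (N n * x)) * (1 - s (r n * x)) 
        - 2 * ((N n * x * s1 (N n * x)) * (r n * x * s1 (r n * x)))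
        - s (N n * x) * ((r n * x)^2 * s2 (r n * x))" for n x
      by (simp add: th2_def algebra_simps power2_eq_square)
    show "\<bar>x^2 * th2 n x\<bar> \<le> A * (1 + A) + B * (1 + A) + A * B + C * (1 + A) + 2 * B * B + A * C" for n x
      using e2[of x n] m[OF C[of "N n * x"] 1[of "r n * x"]] m[OF B[of "N n * x"] B[of "r n * x"]] 
        m[OF A[of "N n * x"] C[of "r n * x"]] nn by linarith
    show "\<forall>\<^sub>F n in sequentially. th n x = 1 \<and> th1 n x = 0 \<and> th2 n x = 0" if x: "x > 0" for x
    proof -
      obtain M where M: "real M > 2 / x + x" using reals_Archimedean2 by blast
      show ?thesis
      proof (rule eventually_sequentiallyI[of M])
        fix n assume "M \<le> n"
        then have "N n > 2 / x + x" using M by (simp add: N_def)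
        moreover have "2 / x > 0" using x by simp
        ultimately have "N n > 2 / x" "N n > x" using x by linarith+
        then have "N n * x > 2" "r n * x < 1" using x N[of n] by (auto simp: field_simps r_def)
        then have "s (N n * x) = 1" "s (r n * x) = 0" "s1 (N n * x) = 0" "s1 (r n * x) = 0"
            "s2 (N n * x) = 0" "s2 (r n * x) = 0"
          using s(2,3) s1_0 s2_0 by auto
        then show "th n x = 1 \<and> th1 n x = 0 \<and> th2 n x = 0"
          by (simp add: th_def th1_def th2_def)
      qed
    qed
  qed
qed

lemma test_fun_iff:
  "test_fun \<phi> \<longleftrightarrow> smooth_on UNIV \<phi> \<and> (\<exists>a b. 0 < a \<and> a < b \<and> (\<forall>x. x \<notin> {a..b} \<longrightarrow> \<phi> x = 0))"
  by (auto simp: test_fun_def smooth_on_def)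

lemma test_fun_lincomb:
  assumes "test_fun \<phi>" "test_fun \<psi>"
  shows "test_fun (\<lambda>x. p * \<phi> x + q * \<psi> x)"
proof -
  obtain a b a' b' where "0 < a" "a < b" "\<forall>x. x \<notin> {a..b} \<longrightarrow> \<phi> x = 0"
    "0 < a'" "a' < b'" "\<forall>x. x \<notin> {a'..b'} \<longrightarrow> \<psi> x = 0"
    using assms by (auto simp: test_fun_iff)
  then have "0 < min a a' \<and> min a a' < max b b' \<and> (\<forall>x. x \<notin> {min a a'..max b b'} \<longrightarrow> p * \<phi> x + q * \<psi> x = 0)"
    by (auto simp: min_def max_def)
  moreover have "smooth_on UNIV (\<lambda>x. p * \<phi> x + q * \<psi> x)"
    using assms unfolding test_fun_iff by (intro smooth_on_add smooth_on_mult smooth_on_const) auto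
  ultimately show ?thesis unfolding test_fun_iff by blast
qed

text \<open>The support interval is widened on both sides, so that the function and its derivatives
  vanish at the end points too and all boundary terms there drop out of integrations by
  parts.\<close>

lemma test_fun_derivs:
  assumes "test_fun \<phi>"
  shows "\<exists>\<phi>' \<phi>'' a b. continuous_on UNIV \<phi>'' \<and> (\<forall>x. (\<phi> has_real_derivative \<phi>' x) (at x))
    \<and> (\<forall>x. (\<phi>' has_real_derivative \<phi>'' x) (at x)) \<and> 0 < a \<and> a < b
    \<and> (\<forall>x. x \<notin> {a<..<b} \<longrightarrow> \<phi> x = 0 \<and> \<phi>' x = 0 \<and> \<phi>'' x = 0)"
proof -
  obtain a b where ab: "0 < a" "a < b" "\<And>x. x \<notin> {a..b} \<Longrightarrow> \<phi> x = 0"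
    using assms by (auto simp: test_fun_iff)
  obtain \<phi>' where 1: "smooth_on UNIV \<phi>'" "\<forall>x. (\<phi> has_real_derivative \<phi>' x) (at x)"
    using assms smooth_on_UNIV_deriv unfolding test_fun_iff by blast
  obtain \<phi>'' where 2: "smooth_on UNIV \<phi>''" "\<forall>x. (\<phi>' has_real_derivative \<phi>'' x) (at x)"
    using smooth_on_UNIV_deriv[OF 1(1)] by blast
  have z1: "\<phi>' x = 0" if "x \<notin> {a..b}" for x
  proof -
    have "(\<phi> has_real_derivative 0) (at x)"
      by (rule has_field_derivative_transform_within_open[of "\<lambda>_. 0" _ _ "- {a..b}"])
         (use that ab in auto)
    then show ?thesis using 1 DERIV_unique by blast
  qed
  have z2: "\<phi>'' x = 0" if "x \<notin> {a..b}" for x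
  proof -
    have "(\<phi>' has_real_derivative 0) (at x)"
      by (rule has_field_derivative_transform_within_open[of "\<lambda>_. 0" _ _ "- {a..b}"])
         (use that z1 in auto)
    then show ?thesis using 2 DERIV_unique by blast
  qed
  show ?thesis
    using ab z1 z2 1 2 smooth_on_continuous[OF 2(1)]
    by (intro exI[of _ \<phi>'] exI[of _ \<phi>''] exI[of _ "a/2"] exI[of _ "b+1"]) auto
qed

section \<open>Weighted square-integrable functions\<close>

definition square_integrable :: "'a measure \<Rightarrow> ('a \<Rightarrow> real) \<Rightarrow> bool" where
  "square_integrable M u \<longleftrightarrow> u \<in> borel_measurable M \<and> integrable M (\<lambda>x. (u x)^2)"

lemma square_integrable_mult:
  assumes "square_integrable M u" "square_integrable M v"
  shows "integrable M (\<lambda>x. u x * v x)"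
proof (rule Bochner_Integration.integrable_bound)
  show "integrable M (\<lambda>x. (u x)^2 + (v x)^2)"
    using assms by (auto simp: square_integrable_def)
  show "(\<lambda>x. u x * v x) \<in> borel_measurable M"
    using assms by (auto simp: square_integrable_def)
  have "\<bar>a * b\<bar> \<le> a^2 + b^2" for a b :: real
    using sum_squares_bound[of "\<bar>a\<bar>" "\<bar>b\<bar>"] mult_nonneg_nonneg[of "\<bar>a\<bar>" "\<bar>b\<bar>"]
    unfolding abs_mult power2_abs by linarith
  then show "AE x in M. norm (u x * v x) \<le> norm ((u x)^2 + (v x)^2)" by simp
qed

lemma square_integrable_lincomb:
  assumes "square_integrable M u" "square_integrable M v"
  shows "square_integrable M (\<lambda>x. a * u x + b * v x)"
proof -
  have "integrable M (\<lambda>x. a^2 * (u x * u x) + 2 * a * b * (u x * v x) + b^2 * (v x * v x))"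
    using assms by (intro Bochner_Integration.integrable_add integrable_mult_right square_integrable_mult)
  also have "(\<lambda>x. a^2 * (u x * u x) + 2 * a * b * (u x * v x) + b^2 * (v x * v x)) = (\<lambda>x. (a * u x + b * v x)^2)"
    by (auto simp: fun_eq_iff power2_eq_square algebra_simps)
  finally show ?thesis using assms by (auto simp: square_integrable_def)
qed

lemma square_integrable_diff:
  "square_integrable M u \<Longrightarrow> square_integrable M v \<Longrightarrow> square_integrable M (\<lambda>x. u x - v x)"
  using square_integrable_lincomb[of M u v 1 "-1"] by simp

lemma integral_square_lincomb:
  assumes "square_integrable M u" "square_integrable M v"
  shows "(\<integral>x. (a * u x + b * v x) * (c * u x + d * v x) \<partial>M) 
    = a * c * (\<integral>x. u x * u x \<partial>M) + (a * d + b * c) * (\<integral>x. u x * v x \<partial>M) + b * d * (\<integral>x. v x * v x \<partial>M)"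
proof -
  have "(\<integral>x. (a * u x + b * v x) * (c * u x + d * v x) \<partial>M) =
     (\<integral>x. a * c * (u x * u x) + (a * d + b * c) * (u x * v x) + b * d * (v x * v x) \<partial>M)"
    by (simp add: algebra_simps)
  then show ?thesis using assms by (simp add: square_integrable_mult)
qed

lemma integral_Cauchy_Schwarz:
  assumes u: "square_integrable M u" and v: "square_integrable M v"
  shows "(\<integral>x. u x * v x \<partial>M)^2 \<le> (\<integral>x. (u x)^2 \<partial>M) * (\<integral>x. (v x)^2 \<partial>M)"
proof -
  define A B C where "A = (\<integral>x. (u x)^2 \<partial>M)" and "B = (\<integral>x. u x * v x \<partial>M)" and "C = (\<integral>x. (v x)^2 \<partial>M)"
  have q: "A - 2 * t * B + t^2 * C \<ge> 0" for t
  proof -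
    have "0 \<le> (\<integral>x. (1 * u x + (- t) * v x) * (1 * u x + (- t) * v x) \<partial>M)" by simp
    then show ?thesis unfolding integral_square_lincomb[OF u v] 
      by (simp add: A_def B_def C_def power2_eq_square)
  qed
  have "C \<ge> 0" by (simp add: C_def)
  have "B^2 \<le> A * C"
  proof (cases "C = 0")
    case True
    have "B = 0"
    proof (rule ccontr)
      assume "B \<noteq> 0"
      \<comment> \<open>For \<open>C = 0\<close> the quadratic is affine in \<open>t\<close>; at
        this \<open>t\<close> it equals -1.\<close>
      then show False using q[of "(A + 1) / (2 * B)"] True by simp
    qed
    then show ?thesis using True by simp
  next
    case False
    then have "C > 0" using \<open>C \<ge> 0\<close> by simp
    then show ?thesis using q[of "B / C"] by (simp add: field_simps power2_eq_square)
  qed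
  then show ?thesis by (simp add: A_def B_def C_def)
qed

text \<open>Expand the product around \<open>F x * G x\<close>; every remaining term contains a
  difference and tends to 0 by Cauchy-Schwarz. All inner products in the uniqueness argument pass to
  the limit this way.\<close>

lemma tendsto_integral_mult:
  assumes fn: "\<And>n. square_integrable M (f n)" and f: "square_integrable M F"
    and gn: "\<And>n. square_integrable M (g n)" and g: "square_integrable M G"
    and limf: "(\<lambda>n. \<integral>x. (f n x - F x)^2 \<partial>M) \<longlonglongrightarrow> 0"
    and limg: "(\<lambda>n. \<integral>x. (g n x - G x)^2 \<partial>M) \<longlonglongrightarrow> 0"
  shows "(\<lambda>n. \<integral>x. f n x * g n x \<partial>M) \<longlonglongrightarrow> (\<integral>x. F x * G x \<partial>M)"
proof -
  have null: "(\<lambda>n. \<integral>x. u n x * v n x \<partial>M) \<longlonglongrightarrow> 0"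
    if u: "\<And>n. square_integrable M (u n)" and v: "\<And>n. square_integrable M (v n)"
      and lim: "(\<lambda>n. (\<integral>x. (u n x)^2 \<partial>M) * (\<integral>x. (v n x)^2 \<partial>M)) \<longlonglongrightarrow> 0" for u v :: "nat \<Rightarrow> 'a \<Rightarrow> real"
  proof (rule Lim_null_comparison)
    show "(\<lambda>n. sqrt ((\<integral>x. (u n x)^2 \<partial>M) * (\<integral>x. (v n x)^2 \<partial>M))) \<longlonglongrightarrow> 0"
      using tendsto_real_sqrt[OF lim] by simp
    show "\<forall>\<^sub>F n in sequentially. norm (\<integral>x. u n x * v n x \<partial>M) \<le> sqrt ((\<integral>x. (u n x)^2 \<partial>M) * (\<integral>x. (v n x)^2 \<partial>M))"
    proof (rule always_eventually, rule allI)
      fix n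
      have "sqrt ((\<integral>x. u n x * v n x \<partial>M)^2) \<le> sqrt ((\<integral>x. (u n x)^2 \<partial>M) * (\<integral>x. (v n x)^2 \<partial>M))"
        by (rule real_sqrt_le_mono, rule integral_Cauchy_Schwarz[OF u v])
      then show "norm (\<integral>x. u n x * v n x \<partial>M) \<le> sqrt ((\<integral>x. (u n x)^2 \<partial>M) * (\<integral>x. (v n x)^2 \<partial>M))"
        by simp
    qed
  qed
  note df = square_integrable_diff[OF fn f] and dg = square_integrable_diff[OF gn g]
  have "(\<lambda>n. \<integral>x. (f n x - F x) * (g n x - G x) \<partial>M) \<longlonglongrightarrow> 0"
    using tendsto_mult[OF limf limg] by (intro null df dg) simp
  moreover have "(\<lambda>n. \<integral>x. F x * (g n x - G x) \<partial>M) \<longlonglongrightarrow> 0"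
    using tendsto_mult[OF tendsto_const limg] by (intro null f dg) simp
  moreover have "(\<lambda>n. \<integral>x. (f n x - F x) * G x \<partial>M) \<longlonglongrightarrow> 0"
    using tendsto_mult[OF limf tendsto_const] by (intro null df g) simp
  ultimately have "(\<lambda>n. (\<integral>x. (f n x - F x) * (g n x - G x) \<partial>M) + (\<integral>x. F x * (g n x - G x) \<partial>M)
      + (\<integral>x. (f n x - F x) * G x \<partial>M) + (\<integral>x. F x * G x \<partial>M)) \<longlonglongrightarrow> 0 + 0 + 0 + (\<integral>x. F x * G x \<partial>M)"
    by (intro tendsto_add tendsto_const)
  moreover have "(\<integral>x. (f n x - F x) * (g n x - G x) \<partial>M) + (\<integral>x. F x * (g n x - G x) \<partial>M)
      + (\<integral>x. (f n x - F x) * G x \<partial>M) + (\<integral>x. F x * G x \<partial>M) = (\<integral>x. f n x * g n x \<partial>M)" for n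
  proof -
    note i = square_integrable_mult[OF df dg] square_integrable_mult[OF f dg] square_integrable_mult[OF df g]
      square_integrable_mult[OF f g]
    have "(\<integral>x. f n x * g n x \<partial>M) = (\<integral>x. (f n x - F x) * (g n x - G x) + F x * (g n x - G x) + (f n x - F x) * G x + F x * G x \<partial>M)"
      by (simp add: algebra_simps)
    also have "\<dots> = (\<integral>x. (f n x - F x) * (g n x - G x) \<partial>M) + (\<integral>x. F x * (g n x - G x) \<partial>M)
      + (\<integral>x. (f n x - F x) * G x \<partial>M) + (\<integral>x. F x * G x \<partial>M)"
      using i by simp
    finally show ?thesis by simp
  qed
  ultimately show ?thesis by simp
qed

text \<open>Weight and half-line are put into one measure, so that \<open>L2rho\<close> becomes
  ordinary square integrability and the preceding lemmas about arbitrary measures apply.\<close>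

definition rho_measure :: "real measure" where
  "rho_measure = density lborel (\<lambda>y. ennreal (indicator {0<..} y * rho y))"

lemma rho_nonneg: "rho y \<ge> 0" by (simp add: rho_def)

lemma rho_measurable [measurable]: "rho \<in> borel_measurable borel"
  unfolding rho_def[abs_def] by measurable

lemma measurable_rho_measure [simp]: "borel_measurable rho_measure = borel_measurable borel"
  unfolding rho_measure_def by (rule measurable_cong_sets) auto

lemma integrable_rho_measure:
  assumes "u \<in> borel_measurable borel"
  shows "integrable rho_measure u \<longleftrightarrow> set_integrable lborel {0<..} (\<lambda>y. rho y * u y)"
  unfolding rho_measure_def set_integrable_def using assms
  by (subst integrable_density) (auto simp: rho_nonneg mult.assoc)

lemma integral_rho_measure:
  assumes "u \<in> borel_measurable borel"
  shows "integral\<^sup>L rho_measure u = (LINT y:{0<..}|lborel. rho y * u y)"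
  unfolding rho_measure_def set_lebesgue_integral_def using assms
  by (subst integral_density) (auto simp: rho_nonneg mult.assoc)

lemma L2rho_iff: "L2rho u \<longleftrightarrow> square_integrable rho_measure u"
  unfolding L2rho_def square_integrable_def by (auto simp: integrable_rho_measure)

lemma L2rho_norm2_eq: "u \<in> borel_measurable borel \<Longrightarrow> L2rho_norm2 u = (\<integral>y. (u y)^2 \<partial>rho_measure)"
  unfolding L2rho_norm2_def by (subst integral_rho_measure) auto

lemma L2rho_norm2_cong: "(\<And>y. y > 0 \<Longrightarrow> u y = v y) \<Longrightarrow> L2rho_norm2 u = L2rho_norm2 v"
  unfolding L2rho_norm2_def by (intro set_lebesgue_integral_cong) auto

text \<open>Bridge between Lebesgue integrals for the weighted measure, used for inner products, and
  gauge integrals on \<open>[a, b]\<close>, to which the fundamental theorem of calculus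
  applies.\<close>

lemma has_integral_rho_measure:
  fixes w :: "real \<Rightarrow> real"
  assumes ab: "0 < a" "a < b" and cont: "continuous_on {a..b} w" and zero: "\<And>y. y \<notin> {a..b} \<Longrightarrow> w y = 0"
  shows "w \<in> borel_measurable borel" "integrable rho_measure w"
    "((\<lambda>y. rho y * w y) has_integral (integral\<^sup>L rho_measure w)) {a..b}"
proof -
  have "w = (\<lambda>y. indicator {a..b} y *\<^sub>R w y)" using zero by (auto simp: fun_eq_iff indicator_def)
  moreover have "(\<lambda>y. indicator {a..b} y *\<^sub>R w y) \<in> borel_measurable borel"
    by (rule borel_measurable_continuous_on_indicator) (use cont in auto)
  ultimately show m: "w \<in> borel_measurable borel" by simp
  have c: "continuous_on {a..b} (\<lambda>y. rho y * w y)"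
    unfolding rho_def by (intro continuous_intros cont) auto
  then have i: "set_integrable lborel {a..b} (\<lambda>y. rho y * w y)"
    by (rule borel_integrable_atLeastAtMost')
  have eq: "(\<lambda>y. indicator {0<..} y *\<^sub>R (rho y * w y)) = (\<lambda>y. indicator {a..b} y *\<^sub>R (rho y * w y))"
    using zero ab by (auto simp: fun_eq_iff indicator_def)
  show "integrable rho_measure w"
    using i unfolding integrable_rho_measure[OF m] set_integrable_def eq .
  have "integral\<^sup>L rho_measure w = (LINT y:{a..b}|lborel. rho y * w y)"
    unfolding integral_rho_measure[OF m] set_lebesgue_integral_def eq ..
  also have "\<dots> = integral {a..b} (\<lambda>y. rho y * w y)"
    by (rule set_borel_integral_eq_integral(2)[OF i])
  finally show "((\<lambda>y. rho y * w y) has_integral (integral\<^sup>L rho_measure w)) {a..b}"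
    using integrable_continuous_interval[OF c] by (simp add: has_integral_integral)
qed

section \<open>The operator on test functions\<close>

lemma rho_has_derivative:
  assumes "y > 0"
  shows "(rho has_real_derivative rho y * (2 / y - y / 2)) (at y)"
  unfolding rho_def[abs_def] using assms
  by (auto intro!: derivative_eq_intros simp: field_simps power2_eq_square)

lemma A0_eq:
  assumes y: "y > 0" and 1: "\<And>x. x > 0 \<Longrightarrow> (\<phi> has_real_derivative \<phi>' x) (at x)"
    and 2: "(\<phi>' has_real_derivative \<phi>'') (at y)"
  shows "A0 f0 \<phi> y = - \<phi>'' - (2 / y - y / 2) * \<phi>' y + 2 * cos (2 * f0 y) / y^2 * \<phi> y"
proof -
  have "((\<lambda>t. rho t * \<phi>' t) has_real_derivative rho y * (2 / y - y / 2) * \<phi>' y + \<phi>'' * rho y) (at y)"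
    by (rule DERIV_mult[OF rho_has_derivative[OF y] 2])
  then have "((\<lambda>t. rho t * deriv \<phi> t) has_real_derivative rho y * (2 / y - y / 2) * \<phi>' y + \<phi>'' * rho y) (at y)"
    by (rule has_field_derivative_transform_within_open[of _ _ _ "{0<..}"]) (use y DERIV_imp_deriv[OF 1] in auto)
  then have "deriv (\<lambda>t. rho t * deriv \<phi> t) y = rho y * (2 / y - y / 2) * \<phi>' y + \<phi>'' * rho y"
    by (rule DERIV_imp_deriv)
  moreover have "rho y \<noteq> 0" using y by (simp add: rho_def)
  ultimately show ?thesis by (simp add: A0_def field_simps)
qed

text \<open>The value 0 at nonpositive arguments leaves the weighted norm unchanged and makes
  linearity and vanishing off the support hold on the whole line.\<close>

definition A0_ext :: "(real \<Rightarrow> real) \<Rightarrow> (real \<Rightarrow> real) \<Rightarrow> real \<Rightarrow> real" where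
  "A0_ext f0 \<phi> y = (if y > 0 then A0 f0 \<phi> y else 0)"

lemma A0_ext_lincomb:
  assumes "test_fun \<phi>" "test_fun \<psi>"
  shows "A0_ext f0 (\<lambda>x. p * \<phi> x + q * \<psi> x) y = p * A0_ext f0 \<phi> y + q * A0_ext f0 \<psi> y"
proof (cases "y > 0")
  case True
  obtain \<phi>' \<phi>'' where 1: "\<forall>x. (\<phi> has_real_derivative \<phi>' x) (at x)" "\<forall>x. (\<phi>' has_real_derivative \<phi>'' x) (at x)"
    using test_fun_derivs[OF assms(1)] by blast
  obtain \<psi>' \<psi>'' where 2: "\<forall>x. (\<psi> has_real_derivative \<psi>' x) (at x)" "\<forall>x. (\<psi>' has_real_derivative \<psi>'' x) (at x)"
    using test_fun_derivs[OF assms(2)] by blast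
  have e1: "A0 f0 (\<lambda>x. p * \<phi> x + q * \<psi> x) y = - (p * \<phi>'' y + q * \<psi>'' y) - (2 / y - y / 2) * (p * \<phi>' y + q * \<psi>' y)
      + 2 * cos (2 * f0 y) / y^2 * (p * \<phi> y + q * \<psi> y)"
    by (rule A0_eq[OF True, of _ "\<lambda>x. p * \<phi>' x + q * \<psi>' x"])
      (use 1 2 in \<open>auto intro!: DERIV_add DERIV_cmult\<close>)
  have e2: "A0 f0 \<phi> y = - \<phi>'' y - (2 / y - y / 2) * \<phi>' y + 2 * cos (2 * f0 y) / y^2 * \<phi> y"
    by (rule A0_eq[OF True]) (use 1 in auto)
  have e3: "A0 f0 \<psi> y = - \<psi>'' y - (2 / y - y / 2) * \<psi>' y + 2 * cos (2 * f0 y) / y^2 * \<psi> y"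
    by (rule A0_eq[OF True]) (use 2 in auto)
  define c v where "c = 2 / y - y / 2" and "v = 2 * cos (2 * f0 y) / y^2"
  show ?thesis using True unfolding A0_ext_def e1 e2 e3 c_def[symmetric] v_def[symmetric]
    by (simp add: algebra_simps)
qed (simp add: A0_ext_def)

definition test_data :: "(real \<Rightarrow> real) \<Rightarrow> (real \<Rightarrow> real) \<Rightarrow> (real \<Rightarrow> real) \<Rightarrow> real \<Rightarrow> real \<Rightarrow> bool" where
  "test_data \<phi> \<phi>' \<phi>'' a b \<longleftrightarrow> continuous_on UNIV \<phi>'' \<and> (\<forall>x. (\<phi> has_real_derivative \<phi>' x) (at x))
    \<and> (\<forall>x. (\<phi>' has_real_derivative \<phi>'' x) (at x)) \<and> 0 < a \<and> a < b
    \<and> (\<forall>x. x \<notin> {a<..<b} \<longrightarrow> \<phi> x = 0 \<and> \<phi>' x = 0 \<and> \<phi>'' x = 0)"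

lemma test_data_exists: "test_fun \<phi> \<Longrightarrow> \<exists>\<phi>' \<phi>'' a b. test_data \<phi> \<phi>' \<phi>'' a b"
  using test_fun_derivs unfolding test_data_def by blast

lemma test_data_enlarge:
  assumes "test_data \<phi> \<phi>' \<phi>'' a b" "0 < a'" "a' \<le> a" "b \<le> b'"
  shows "test_data \<phi> \<phi>' \<phi>'' a' b'"
  using assms unfolding test_data_def by auto

lemma test_data_continuous:
  assumes "test_data \<phi> \<phi>' \<phi>'' a b"
  shows "continuous_on S \<phi>" "continuous_on S \<phi>'" "continuous_on S \<phi>''"
proof -
  have "isCont \<phi> x" "isCont \<phi>' x" for x using assms unfolding test_data_def by (blast intro: DERIV_isCont)+
  then show "continuous_on S \<phi>" "continuous_on S \<phi>'" by (auto intro: continuous_at_imp_continuous_on)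
  show "continuous_on S \<phi>''"
    using assms continuous_on_subset[of UNIV \<phi>'' S] by (simp add: test_data_def)
qed

lemma A0_ext_eq:
  assumes "test_data \<phi> \<phi>' \<phi>'' a b" "y \<in> {a..b}"
  shows "A0_ext f0 \<phi> y = - \<phi>'' y - (2 / y - y / 2) * \<phi>' y + 2 * cos (2 * f0 y) / y^2 * \<phi> y"
proof -
  have "y > 0" using assms by (auto simp: test_data_def)
  moreover have "A0 f0 \<phi> y = - \<phi>'' y - (2 / y - y / 2) * \<phi>' y + 2 * cos (2 * f0 y) / y^2 * \<phi> y"
    by (rule A0_eq[OF \<open>y > 0\<close>]) (use assms in \<open>auto simp: test_data_def\<close>)
  ultimately show ?thesis by (simp add: A0_ext_def)
qed

lemma A0_ext_zero:
  assumes "test_data \<phi> \<phi>' \<phi>'' a b" "y \<notin> {a..b}"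
  shows "A0_ext f0 \<phi> y = 0"
proof (cases "y > 0")
  case True
  have "A0 f0 \<phi> y = - \<phi>'' y - (2 / y - y / 2) * \<phi>' y + 2 * cos (2 * f0 y) / y^2 * \<phi> y"
    by (rule A0_eq[OF True]) (use assms in \<open>auto simp: test_data_def\<close>)
  moreover have "y \<notin> {a<..<b}" using assms(2) by auto
  ultimately show ?thesis using assms by (simp add: A0_ext_def test_data_def)
qed (simp add: A0_ext_def)

lemma A0_ext_continuous:
  assumes "continuous_on {0<..} f0" and d: "test_data \<phi> \<phi>' \<phi>'' a b"
  shows "continuous_on {a..b} (A0_ext f0 \<phi>)"
proof -
  have "0 < a" using d by (simp add: test_data_def)
  then have "continuous_on {a..b} f0" by (intro continuous_on_subset[OF assms(1)]) auto
  then have "continuous_on {a..b} (\<lambda>y. - \<phi>'' y - (2 / y - y / 2) * \<phi>' y + 2 * cos (2 * f0 y) / y^2 * \<phi> y)"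
    using \<open>0 < a\<close> by (intro continuous_intros test_data_continuous[OF d]) auto
  then show ?thesis by (rule continuous_on_eq) (use A0_ext_eq[OF d] in auto)
qed

lemma test_data_square_integrable:
  assumes "continuous_on {0<..} f0" and d: "test_data \<phi> \<phi>' \<phi>'' a b"
  shows "square_integrable rho_measure \<phi>" "square_integrable rho_measure (A0_ext f0 \<phi>)"
proof -
  have ab: "0 < a" "a < b" using d by (auto simp: test_data_def)
  have z: "\<phi> y = 0" "A0_ext f0 \<phi> y = 0" if "y \<notin> {a..b}" for y
    using that d A0_ext_zero[OF d] by (auto simp: test_data_def)
  note c = test_data_continuous(1)[OF d, of "{a..b}"] A0_ext_continuous[OF assms]
  show "square_integrable rho_measure \<phi>"
    unfolding square_integrable_def measurable_rho_measure
    using z by (intro conjI has_integral_rho_measure[OF ab] continuous_intros c) auto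
  show "square_integrable rho_measure (A0_ext f0 \<phi>)"
    unfolding square_integrable_def measurable_rho_measure
    using z by (intro conjI has_integral_rho_measure[OF ab] continuous_intros c) auto
qed

text \<open>Lagrange's identity: \<open>rho\<close> times the difference of the two integrands is
  the derivative of the weighted Wronskian, which vanishes at both ends of a common support.\<close>

lemma A0_symmetric:
  assumes f0: "continuous_on {0<..} f0" and \<phi>: "test_fun \<phi>" and \<psi>: "test_fun \<psi>"
  shows "(\<integral>y. A0_ext f0 \<phi> y * \<psi> y \<partial>rho_measure) = (\<integral>y. \<phi> y * A0_ext f0 \<psi> y \<partial>rho_measure)"
proof -
  obtain \<phi>' \<phi>'' \<psi>' \<psi>'' a1 b1 a2 b2 where d0: "test_data \<phi> \<phi>' \<phi>'' a1 b1" "test_data \<psi> \<psi>' \<psi>'' a2 b2"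
    using test_data_exists[OF \<phi>] test_data_exists[OF \<psi>] by blast
  define a b where "a = min a1 a2" and "b = max b1 b2"
  have d: "test_data \<phi> \<phi>' \<phi>'' a b" "test_data \<psi> \<psi>' \<psi>'' a b"
    using d0 by (auto simp: a_def b_def test_data_def min_def max_def intro!: test_data_enlarge[OF d0(1)] test_data_enlarge[OF d0(2)])
  have ab: "0 < a" "a < b" using d by (auto simp: test_data_def)
  let ?w = "\<lambda>y. A0_ext f0 \<phi> y * \<psi> y - \<phi> y * A0_ext f0 \<psi> y"
  have "((\<lambda>y. rho y * ?w y) has_integral (integral\<^sup>L rho_measure ?w)) {a..b}"
    using d A0_ext_zero
    by (intro has_integral_rho_measure[OF ab] continuous_intros A0_ext_continuous[OF f0] test_data_continuous) auto
  moreover have "((\<lambda>y. rho y * ?w y) has_integral 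
      rho b * (\<phi> b * \<psi>' b - \<phi>' b * \<psi> b) - rho a * (\<phi> a * \<psi>' a - \<phi>' a * \<psi> a)) {a..b}"
  proof (rule fundamental_theorem_of_calculus)
    fix y assume y: "y \<in> {a..b}"
    have "((\<lambda>y. rho y * (\<phi> y * \<psi>' y - \<phi>' y * \<psi> y)) has_real_derivative rho y * ?w y) (at y)"
      using d ab y
      by (auto simp: test_data_def A0_ext_eq[OF d(1)] A0_ext_eq[OF d(2)] algebra_simps
           intro!: derivative_eq_intros rho_has_derivative)
    then show "((\<lambda>y. rho y * (\<phi> y * \<psi>' y - \<phi>' y * \<psi> y)) has_vector_derivative rho y * ?w y) (at y within {a..b})"
      by (simp add: has_real_derivative_iff_has_vector_derivative has_vector_derivative_at_within)
  qed (use ab in auto)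
  moreover have "\<phi> a = 0" "\<phi>' a = 0" "\<phi> b = 0" "\<phi>' b = 0" using d by (auto simp: test_data_def)
  ultimately have "integral\<^sup>L rho_measure ?w = 0" by (simp add: has_integral_unique)
  moreover note s = test_data_square_integrable[OF f0 d(1)] test_data_square_integrable[OF f0 d(2)]
  moreover have "integral\<^sup>L rho_measure ?w = (\<integral>y. A0_ext f0 \<phi> y * \<psi> y \<partial>rho_measure) - (\<integral>y. \<phi> y * A0_ext f0 \<psi> y \<partial>rho_measure)"
    by (rule Bochner_Integration.integral_diff) (intro square_integrable_mult s)+
  ultimately show ?thesis by simp
qed

text \<open>Jacobi's completion of the square. With \<open>g y = G (y^2) / y\<close> the boundary
  expression is \<open>H = rho * g * \<phi>^2 - rho * \<phi> * \<phi>'\<close>. Subtracting its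
  derivative from the integrand leaves \<open>rho * (\<phi>' - g * \<phi>)^2\<close> plus
  \<open>rho * \<phi>^2\<close> times the slack in the Riccati inequality, both nonnegative. Working
  on a subinterval allows a different \<open>G\<close> on each piece.\<close>

lemma riccati_piece:
  assumes f0: "continuous_on {0<..} f0" and d: "test_data \<phi> \<phi>' \<phi>'' a b"
    and lr: "a \<le> l" "l \<le> r" "r \<le> b"
    and G: "\<And>y. y \<in> {l..r} \<Longrightarrow> (G has_real_derivative G' (y^2)) (at (y^2))"
    and ric: "\<And>y. y \<in> {l..r} \<Longrightarrow> 2 * y^2 * G' (y^2) + (G (y^2))^2 + G (y^2) - y^2 * G (y^2) / 2 + e * y^2 \<le> 2 * cos (2 * f0 y)"
  defines "H \<equiv> \<lambda>y. y * exp (- (y^2) / 4) * G (y^2) * (\<phi> y)^2 - rho y * \<phi> y * \<phi>' y"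
  shows "H r - H l \<le> integral {l..r} (\<lambda>y. rho y * (\<phi> y * A0_ext f0 \<phi> y - e * (\<phi> y)^2))"
proof (rule has_integral_le)
  have pos: "0 < a" "a < b" using d by (auto simp: test_data_def)
  let ?E = "\<lambda>y. exp (- (y^2) / 4)"
  define g where "g = (\<lambda>y. G (y^2))"
  define H' where "H' y = ?E y * ((1 - y^2 / 2) * g y * (\<phi> y)^2 + 2 * y^2 * G' (y^2) * (\<phi> y)^2 + 2 * y * g y * \<phi> y * \<phi>' y)
      - rho y * ((2 / y - y / 2) * \<phi> y * \<phi>' y + (\<phi>' y)^2 + \<phi> y * \<phi>'' y)" for y
  show "(H' has_integral H r - H l) {l..r}"
  proof (rule fundamental_theorem_of_calculus)
    fix y assume y: "y \<in> {l..r}"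
    have Gy: "(g has_real_derivative G' (y^2) * (2 * y)) (at y)"
      unfolding g_def by (rule DERIV_chain2[where f = G and g = "\<lambda>y. y^2", OF G[OF y]]) (auto intro!: derivative_eq_intros)
    have H_g: "H = (\<lambda>y. y * exp (- (y^2) / 4) * g y * (\<phi> y)^2 - rho y * \<phi> y * \<phi>' y)"
      by (simp add: H_def g_def)
    have "(H has_real_derivative H' y) (at y)"
      unfolding H_g H'_def using d pos y lr
      by (auto intro!: derivative_eq_intros Gy rho_has_derivative
          simp: test_data_def algebra_simps power2_eq_square)
    then show "(H has_vector_derivative H' y) (at y within {l..r})"
      by (simp add: has_real_derivative_iff_has_vector_derivative has_vector_derivative_at_within)
  qed (use lr in auto)
  have sub: "{l..r} \<subseteq> {a..b}" using lr by auto
  have "continuous_on {l..r} (\<lambda>y. rho y * (\<phi> y * A0_ext f0 \<phi> y - e * (\<phi> y)^2))"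
    unfolding rho_def
    by (intro continuous_intros test_data_continuous[OF d] continuous_on_subset[OF A0_ext_continuous[OF f0 d] sub]) auto
  then show "((\<lambda>y. rho y * (\<phi> y * A0_ext f0 \<phi> y - e * (\<phi> y)^2)) has_integral
      integral {l..r} (\<lambda>y. rho y * (\<phi> y * A0_ext f0 \<phi> y - e * (\<phi> y)^2))) {l..r}"
    using integrable_continuous_interval by (simp add: has_integral_integral)
  fix y assume y: "y \<in> {l..r}"
  then have y0: "y > 0" "y \<in> {a..b}" using pos lr by auto
  have "rho y * (\<phi> y * A0_ext f0 \<phi> y - e * (\<phi> y)^2) - H' y
     = ?E y * ((y * \<phi>' y - G (y^2) * \<phi> y)^2
       + (2 * cos (2 * f0 y) - (2 * y^2 * G' (y^2) + (G (y^2))^2 + G (y^2) - y^2 * G (y^2) / 2 + e * y^2)) * (\<phi> y)^2)"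
    unfolding A0_ext_eq[OF d y0(2)] H'_def g_def rho_def using y0(1)
    by (simp add: field_simps power2_eq_square)
  also have "\<dots> \<ge> 0"
    using ric[OF y] by (intro mult_nonneg_nonneg add_nonneg_nonneg) auto
  finally show "H' y \<le> rho y * (\<phi> y * A0_ext f0 \<phi> y - e * (\<phi> y)^2)" by simp
qed

lemma riccati_near_0_derivative:
  fixes z :: real
  assumes "1 + 7 * z > 0"
  shows "((\<lambda>z. (1 - 35/2 * z) / (1 + 7 * z)) has_real_derivative - (49/2) / (1 + 7 * z)^2) (at z)"
proof -
  have "((\<lambda>z. (1 - 35/2 * z) / (1 + 7 * z)) has_real_derivative
      ((- (35/2)) * (1 + 7 * z) - (1 - 35/2 * z) * 7) / ((1 + 7 * z) * (1 + 7 * z))) (at z)"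
    using assms by (intro DERIV_divide) (auto intro!: derivative_eq_intros)
  also have "(- (35/2)) * (1 + 7 * z) - (1 - 35/2 * z) * 7 = - (49/2)" by (simp add: algebra_simps)
  finally show ?thesis by (simp add: power2_eq_square)
qed

lemma form_lower_bound:
  assumes f0: "continuous_on {0<..} f0" and close: "\<And>y. y > 0 \<Longrightarrow> \<bar>p1 y * (f0 y - f0_approx y)\<bar> \<le> 5/10000"
    and \<phi>: "test_fun \<phi>" and zero: "\<phi> (sqrt (3/10)) = 0"
  shows "(\<integral>y. \<phi> y * A0_ext f0 \<phi> y \<partial>rho_measure) \<ge> 1/200 * (\<integral>y. \<phi> y * \<phi> y \<partial>rho_measure)"
proof -
  define m s where "m = sqrt (1/10)" and "s = sqrt (3/10)"
  have ms: "0 < m" "m < s" "m^2 = 1/10" "s^2 = 3/10" by (auto simp: m_def s_def)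
  obtain \<phi>' \<phi>'' a0 b0 where d0: "test_data \<phi> \<phi>' \<phi>'' a0 b0" using test_data_exists[OF \<phi>] by blast
  \<comment> \<open>The interval is enlarged to contain both break points, so that the splitting
    into three pieces is the same for every test function.\<close>
  define a b where "a = min a0 m" and "b = max b0 s"
  have d: "test_data \<phi> \<phi>' \<phi>'' a b"
    using d0 ms by (intro test_data_enlarge[OF d0]) (auto simp: a_def b_def test_data_def)
  have ab: "0 < a" "a < b" "a \<le> m" "s \<le> b" using d by (auto simp: test_data_def a_def b_def)
  let ?Q = "\<lambda>y. rho y * (\<phi> y * A0_ext f0 \<phi> y - 1/200 * (\<phi> y)^2)"
  define H where "H G y = y * exp (- (y^2) / 4) * G (y^2) * (\<phi> y)^2 - rho y * \<phi> y * \<phi>' y" for G y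
  define G1 G2 G3 :: "real \<Rightarrow> real" where "G1 z = (1 - 35/2 * z) / (1 + 7 * z)" and "G2 z = 3/10 - 17/2 * z"
    and "G3 z = 1/10 + 17/100 / z^2" for z
  have 1: "H G1 m - H G1 a \<le> integral {a..m} ?Q"
    unfolding H_def
  proof (rule riccati_piece[OF f0 d, where G' = "\<lambda>z. - (49/2) / (1 + 7 * z)^2"])
    fix y assume y: "y \<in> {a..m}"
    then have y0: "y > 0" using ab by simp
    have "y^2 \<le> m^2" using y y0 by (intro power_mono) auto
    then have z: "0 < y^2" "y^2 \<le> 1/10" using y0 ms by auto
    have "1 + 7 * y^2 > 0" using z by linarith
    then show "(G1 has_real_derivative - (49/2) / (1 + 7 * y^2)^2) (at (y^2))"
      unfolding G1_def[abs_def] by (rule riccati_near_0_derivative)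
    obtain t where t: "2 * cos (2 * f0 y) \<ge> 2 - 16 * t / (1 + t)^2 - y^2 / 40"
      "t \<ge> 133/10 * y^2 / (2 + y^2)" "t \<le> 151/10 * y^2 / (2 + y^2)"
      using potential_lower_bound[OF y0 close[OF y0]] by metis
    have "t \<ge> 0" using z by (intro order_trans[OF _ t(2)]) auto
    \<comment> \<open>The budget on each piece: \<open>3/100\<close> from the Riccati inequality
      minus \<open>1/40\<close> from the potential leaves \<open>1/200\<close>.\<close>
    then show "2 * y^2 * (- (49/2) / (1 + 7 * y^2)^2) + (G1 (y^2))^2 + G1 (y^2) - y^2 * G1 (y^2) / 2 + 1/200 * y^2 \<le> 2 * cos (2 * f0 y)"
      using riccati_near_0[OF z _ t(3)] t(1) unfolding G1_def by linarith
  qed (use ab ms in auto)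
  have 2: "H G2 s - H G2 m \<le> integral {m..s} ?Q"
    unfolding H_def
  proof (rule riccati_piece[OF f0 d, where G' = "\<lambda>z. - (17/2)"])
    fix y assume y: "y \<in> {m..s}"
    then have y0: "y > 0" using ms by simp
    have "y^2 \<le> s^2" "m^2 \<le> y^2" using y y0 ms by (auto intro!: power_mono)
    then have z: "1/10 \<le> y^2" "y^2 \<le> 3/10" using ms by auto
    show "(G2 has_real_derivative - (17/2)) (at (y^2))"
      unfolding G2_def[abs_def] by (auto intro!: derivative_eq_intros)
    obtain t where t: "2 * cos (2 * f0 y) \<ge> 2 - 16 * t / (1 + t)^2 - y^2 / 40"
      "t \<le> 151/10 * y^2 / (2 + y^2)" "t \<ge> 142/10 * y^2 / (2 + y^2)"
      using potential_lower_bound[OF y0 close[OF y0]] z by metis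
    show "2 * y^2 * (- (17/2)) + (G2 (y^2))^2 + G2 (y^2) - y^2 * G2 (y^2) / 2 + 1/200 * y^2 \<le> 2 * cos (2 * f0 y)"
      using riccati_middle[OF z t(3) t(2)] t(1) unfolding G2_def by linarith
  qed (use ab ms in auto)
  have 3: "H G3 b - H G3 s \<le> integral {s..b} ?Q"
    unfolding H_def
  proof (rule riccati_piece[OF f0 d, where G' = "\<lambda>z. - (34/100) / z^3"])
    fix y assume y: "y \<in> {s..b}"
    then have y0: "y > 0" using ms by simp
    have "s^2 \<le> y^2" using y y0 ms by (auto intro!: power_mono)
    then have z: "3/10 \<le> y^2" using ms by auto
    show "(G3 has_real_derivative - (34/100) / (y^2)^3) (at (y^2))"
      unfolding G3_def[abs_def] using y0 by (auto intro!: derivative_eq_intros simp: field_simps eval_nat_numeral)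
    obtain t where t: "2 * cos (2 * f0 y) \<ge> 2 - 16 * t / (1 + t)^2 - y^2 / 40"
      "t \<ge> 133/10 * y^2 / (2 + y^2)"
      using potential_lower_bound[OF y0 close[OF y0]] by metis
    show "2 * y^2 * (- (34/100) / (y^2)^3) + (G3 (y^2))^2 + G3 (y^2) - y^2 * G3 (y^2) / 2 + 1/200 * y^2 \<le> 2 * cos (2 * f0 y)"
      using riccati_outer[OF z t(2)] t(1) unfolding G3_def by linarith
  qed (use ab ms in auto)
  have cont: "continuous_on {a..b} (\<lambda>y. \<phi> y * A0_ext f0 \<phi> y - 1/200 * (\<phi> y)^2)"
    by (intro continuous_intros test_data_continuous[OF d] A0_ext_continuous[OF f0 d])
  have z: "\<phi> y * A0_ext f0 \<phi> y - 1/200 * (\<phi> y)^2 = 0" if "y \<notin> {a..b}" for y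
    using that d by (auto simp: test_data_def)
  note hi = has_integral_rho_measure(3)[OF ab(1,2) cont z]
  have int: "?Q integrable_on {a..b}" using hi by blast
  have "integral {a..b} ?Q = integral {a..m} ?Q + integral {m..b} ?Q"
    using ab ms int by (intro Henstock_Kurzweil_Integration.integral_combine[symmetric]) auto
  also have "integral {m..b} ?Q = integral {m..s} ?Q + integral {s..b} ?Q"
    using ab ms by (intro Henstock_Kurzweil_Integration.integral_combine[symmetric] integrable_subinterval_real[OF int]) auto
  also have "integral {a..m} ?Q + (integral {m..s} ?Q + integral {s..b} ?Q) 
      \<ge> (H G1 m - H G1 a) + ((H G2 s - H G2 m) + (H G3 b - H G3 s))"
    by (intro add_mono 1 2 3)
  \<comment> \<open>The terms at \<open>a\<close> and \<open>b\<close> vanish by the support, those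
    at \<open>s\<close> by \<open>zero\<close>. At \<open>m\<close> the parts with the derivative
    cancel, and the downward jump from \<open>G1 (1/10) = -15/34\<close> to
    \<open>G2 (1/10) = -11/20\<close> remains with the favourable sign.\<close>
  also have "(H G1 m - H G1 a) + ((H G2 s - H G2 m) + (H G3 b - H G3 s)) = H G1 m - H G2 m"
    using zero d by (simp add: H_def s_def test_data_def)
  also have "\<dots> = m * exp (- (m^2) / 4) * (G1 (1/10) - G2 (1/10)) * (\<phi> m)^2"
    by (simp add: H_def ms algebra_simps)
  also have "\<dots> \<ge> 0" using ms by (intro mult_nonneg_nonneg) (auto simp: G1_def G2_def)
  finally have "0 \<le> (\<integral>y. \<phi> y * A0_ext f0 \<phi> y - 1/200 * (\<phi> y)^2 \<partial>rho_measure)"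
    using integral_unique[OF hi] by simp
  also have "\<dots> = (\<integral>y. \<phi> y * A0_ext f0 \<phi> y \<partial>rho_measure) - (\<integral>y. 1/200 * (\<phi> y)^2 \<partial>rho_measure)"
    using test_data_square_integrable[OF f0 d]
    by (intro Bochner_Integration.integral_diff square_integrable_mult integrable_mult_right) (auto simp: square_integrable_def)
  also have "(\<integral>y. 1/200 * (\<phi> y)^2 \<partial>rho_measure) = 1/200 * (\<integral>y. \<phi> y * \<phi> y \<partial>rho_measure)"
    unfolding power2_eq_square by (rule integral_mult_right_zero)
  finally show ?thesis by simp
qed

section \<open>Approximating the mode in the graph norm\<close>

lemma smooth_on_cheb_T: "smooth_on UNIV (cheb_T n)"
proof (induction n rule: induct_nat_012)
  case 0
  have "cheb_T 0 = (\<lambda>x. 1)" by (simp add: fun_eq_iff)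
  then show ?case using smooth_on_const by metis
next
  case 1
  have "cheb_T (Suc 0) = (\<lambda>x. x)" by (simp add: fun_eq_iff)
  then show ?case using smooth_on_ident by metis
next
  case (ge2 n)
  have "smooth_on UNIV (\<lambda>x. (2 * x) * cheb_T (Suc n) x + (-1) * cheb_T n x)"
    by (intro smooth_on_add smooth_on_mult smooth_on_const smooth_on_ident ge2)
  moreover have "(\<lambda>x. (2 * x) * cheb_T (Suc n) x + (-1) * cheb_T n x) = cheb_T (Suc (Suc n))"
    by (simp add: fun_eq_iff)
  ultimately show ?case by simp
qed

lemma smooth_on_sum:
  "finite A \<Longrightarrow> (\<And>i. i \<in> A \<Longrightarrow> smooth_on S (f i)) \<Longrightarrow> smooth_on S (\<lambda>x. \<Sum>i\<in>A. f i x)"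
proof (induction A rule: finite_induct)
  case empty
  then show ?case by (simp add: smooth_on_const)
next
  case (insert a A)
  then have "smooth_on S (\<lambda>x. f a x + (\<Sum>i\<in>A. f i x))" by (intro smooth_on_add) auto
  then show ?case using insert by simp
qed

text \<open>The map \<open>y / sqrt (2 + y^2)\<close> takes the line into \<open>[-1, 1]\<close> and
  has bounded slope; compactness then bounds the derivative of \<open>cheb_sum\<close> on its
  range.\<close>

lemma f0_approx_deriv_bounded:
  obtains K where "\<And>y. \<bar>deriv f0_approx y\<bar> \<le> K"
proof -
  have "smooth_on UNIV cheb_sum"
    unfolding cheb_sum_def[abs_def] by (intro smooth_on_sum smooth_on_mult smooth_on_const smooth_on_cheb_T) auto
  then obtain S' where S': "smooth_on UNIV S'" "\<forall>x. (cheb_sum has_real_derivative S' x) (at x)"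
    using smooth_on_UNIV_deriv by blast
  have "continuous_on {-1..1} S'"
    using continuous_on_subset[OF smooth_on_continuous[OF S'(1)]] by simp
  then have "bounded (S' ` {-1..1})" by (intro compact_imp_bounded compact_continuous_image) auto
  then obtain K where K: "\<forall>v\<in>S' ` {-1..1}. norm v \<le> K" unfolding bounded_iff by blast
  have "\<bar>deriv f0_approx y\<bar> \<le> 2 * K" for y
  proof -
    define s where "s = sqrt (2 + y^2)"
    have pos: "2 + y^2 > 0" by (simp add: add_pos_nonneg)
    have s: "s \<ge> 1" "s^2 = 2 + y^2" using pos by (auto simp: s_def)
    define x where "x = y / s"
    have x2: "x^2 = y^2 / (2 + y^2)" by (simp add: x_def power_divide s)
    have "x^2 \<le> 1" using pos by (simp add: x2)
    then have x1: "\<bar>x\<bar> \<le> 1" by (simp add: abs_square_le_1)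
    have dx: "((\<lambda>y. y / sqrt (2 + y^2)) has_real_derivative (1 - x^2) / s) (at y)"
    proof -
      have "((\<lambda>y. y / sqrt (2 + y^2)) has_real_derivative (1 * s - y * (inverse s / 2 * (2 * y))) / (s * s)) (at y)"
        unfolding s_def using pos
        by (intro DERIV_divide) (auto intro!: derivative_eq_intros)
      also have "(1 * s - y * (inverse s / 2 * (2 * y))) / (s * s) = (1 - x^2) / s"
        using s(1) by (simp add: x_def field_simps power2_eq_square)
      finally show ?thesis .
    qed
    have "(f0_approx has_real_derivative 2 * (inverse (1 + (cheb_sum x)^2) * (S' x * ((1 - x^2) / s)))) (at y)"
    proof -
      have "((\<lambda>y. cheb_sum (y / sqrt (2 + y^2))) has_real_derivative S' x * ((1 - x^2) / s)) (at y)"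
        by (rule DERIV_chain2[OF _ dx]) (use S'(2) in \<open>simp add: x_def s_def\<close>)
      then have "((\<lambda>y. 2 * arctan (cheb_sum (y / sqrt (2 + y^2)))) has_real_derivative 
          2 * (inverse (1 + (cheb_sum (y / sqrt (2 + y^2)))^2) * (S' x * ((1 - x^2) / s)))) (at y)"
        by (intro DERIV_cmult DERIV_chain2[OF DERIV_arctan])
      then show ?thesis by (simp add: f0_approx_def[abs_def] cheb_sum_def x_def s_def)
    qed
    then have "deriv f0_approx y = 2 * (inverse (1 + (cheb_sum x)^2) * (S' x * ((1 - x^2) / s)))"
      by (rule DERIV_imp_deriv)
    also have "\<bar>\<dots>\<bar> = 2 * (inverse (1 + (cheb_sum x)^2) * (\<bar>S' x\<bar> * ((1 - x^2) / s)))"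
      using s \<open>x^2 \<le> 1\<close> by (simp add: abs_mult)
    also have "\<dots> \<le> 2 * (1 * (K * 1))"
    proof (intro mult_left_mono mult_mono)
      show "inverse (1 + (cheb_sum x)^2) \<le> 1" by (simp add: inverse_le_1_iff)
      show "\<bar>S' x\<bar> \<le> K" using K x1 by (auto simp: abs_le_iff)
      then show "0 \<le> K" by simp
      have "1 - x^2 \<le> s" using s(1) zero_le_power2[of x] by linarith
      then show "(1 - x^2) / s \<le> 1" using s(1) by simp
    qed (use s \<open>x^2 \<le> 1\<close> in auto)
    finally show ?thesis by simp
  qed
  then show ?thesis using that by blast
qed

section \<open>Pointwise bounds and dominated convergence in the weighted space\<close>

lemma p3_ge_1: "p3 y \<ge> 1"
proof -
  have "(2::real) powr (3/2) = 2 powr (1 + 1/2)" by simp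
  also have "\<dots> = 2 * sqrt 2" unfolding powr_add by (simp add: powr_half_sqrt)
  finally have "2 * sqrt 2 = (2::real) powr (3/2)" by simp
  also have "\<dots> \<le> (2 + y^2) powr (3/2)" by (intro powr_mono2) auto
  finally show ?thesis by (simp add: p3_def)
qed

text \<open>The bound is on \<open>y * u\<close> because \<open>rho\<close> carries a factor
  \<open>y^2\<close>: a singularity \<open>1/y\<close> at the origin is admissible, and cutting off
  the mode produces one. Half of the Gaussian absorbs \<open>(1 + y^2)^2\<close>; the other half
  lies below \<open>exp (2 - y)\<close> since \<open>(y - 4)^2\<close> is nonnegative.\<close>

lemma rho_square_le:
  assumes y: "y > 0" and u: "\<bar>y * u\<bar> \<le> C * (1 + y^2)"
  shows "rho y * u^2 \<le> C^2 * (256 * exp 2) * exp (- y)"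
proof -
  have "0 < 1 + y^2" by (simp add: add_pos_nonneg)
  have "1 + y^2 \<le> 16 * (1 + y^2 / 16)" by simp
  also have "\<dots> \<le> 16 * exp (y^2 / 16)" by (intro mult_left_mono exp_ge_add_one_self) auto
  finally have "(1 + y^2)^2 \<le> (16 * exp (y^2 / 16))^2" using \<open>0 < 1 + y^2\<close> by (intro power_mono) auto
  also have "\<dots> = 256 * exp (y^2 / 8)" by (simp add: power_mult_distrib exp_double[symmetric])
  finally have 1: "(1 + y^2)^2 \<le> 256 * exp (y^2 / 8)" .
  have "rho y * u^2 = exp (- (y^2) / 4) * \<bar>y * u\<bar>^2" by (simp add: rho_def power_mult_distrib)
  also have "\<dots> \<le> exp (- (y^2) / 4) * (C * (1 + y^2))^2"
    by (intro mult_left_mono power_mono u) auto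
  also have "\<dots> = C^2 * (exp (- (y^2) / 4) * (1 + y^2)^2)" by (simp add: power_mult_distrib)
  also have "\<dots> \<le> C^2 * (exp (- (y^2) / 4) * (256 * exp (y^2 / 8)))"
    by (intro mult_left_mono 1) auto
  also have "\<dots> = C^2 * (256 * exp (- (y^2) / 8))" by (simp add: exp_add[symmetric])
  also have "\<dots> \<le> C^2 * (256 * exp (2 - y))"
  proof -
    have "0 \<le> (y - 4)^2" by simp
    then have "- (y^2) / 8 \<le> 2 - y" by (simp add: power2_eq_square algebra_simps)
    then show ?thesis by (intro mult_left_mono) auto
  qed
  also have "\<dots> = C^2 * (256 * exp 2) * exp (- y)" by (simp add: exp_diff exp_minus field_simps)
  finally show ?thesis .
qed

lemma integrable_exp_minus: "integrable lborel (\<lambda>y::real. indicator {0<..} y * (c * exp (- y)))"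
proof -
  have "(\<lambda>y::real. exp (- 1 * y)) absolutely_integrable_on {0..}"
    by (intro nonnegative_absolutely_integrable_1 integrable_on_exp_minus_to_infinity) auto
  then have "integrable lebesgue (\<lambda>y::real. indicator {0..} y *\<^sub>R exp (- y))"
    by (simp add: set_integrable_def)
  then have "integrable lborel (\<lambda>y::real. indicator {0..} y *\<^sub>R exp (- y))"
    by (subst (asm) integrable_completion) auto
  then have "integrable lborel (\<lambda>y::real. c * (indicator {0..} y *\<^sub>R exp (- y)))" by simp
  then show ?thesis
    by (rule Bochner_Integration.integrable_bound) (auto simp: indicator_def)
qed

lemma square_integrable_rho_measureI:
  assumes u: "u \<in> borel_measurable borel" and bound: "\<And>y. y > 0 \<Longrightarrow> \<bar>y * u y\<bar> \<le> C * (1 + y^2)"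
  shows "square_integrable rho_measure u"
proof -
  have "integrable lborel (\<lambda>y. indicator {0<..} y *\<^sub>R (rho y * (u y)^2))"
    using u bound rho_square_le
    by (intro Bochner_Integration.integrable_bound[OF integrable_exp_minus[of "C^2 * (256 * exp 2)"]])
       (auto simp: indicator_def rho_nonneg)
  then have "integrable rho_measure (\<lambda>y. (u y)^2)"
    using u by (subst integrable_rho_measure) (auto simp: set_integrable_def)
  then show ?thesis using u by (simp add: square_integrable_def)
qed

text \<open>Dominated convergence with the majorant of \<open>rho_square_le\<close>. Measurability
  is asked only after multiplication by the indicator, because the functions \<open>D n\<close> are
  unspecified at negative arguments.\<close>

lemma L2rho_norm2_tendsto_0:
  assumes u: "\<And>n. (\<lambda>y. indicator {0<..} y * u n y) \<in> borel_measurable borel" 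
    and bound: "\<And>n y. y > 0 \<Longrightarrow> \<bar>y * u n y\<bar> \<le> C * (1 + y^2)"
    and lim: "\<And>y. y > 0 \<Longrightarrow> (\<lambda>n. u n y) \<longlonglongrightarrow> 0"
  shows "(\<lambda>n. L2rho_norm2 (u n)) \<longlonglongrightarrow> 0"
proof -
  have eq: "(\<lambda>y. indicator {0<..} y *\<^sub>R (rho y * (u n y)^2)) = (\<lambda>y. rho y * (indicator {0<..} y * u n y)^2)" for n
    by (auto simp: fun_eq_iff indicator_def)
  have "(\<lambda>n. \<integral>y. indicator {0<..} y *\<^sub>R (rho y * (u n y)^2) \<partial>lborel) \<longlonglongrightarrow> (\<integral>y. 0 \<partial>(lborel :: real measure))"
  proof (rule integral_dominated_convergence)
    show "integrable lborel (\<lambda>y::real. indicator {0<..} y * (C^2 * (256 * exp 2) * exp (- y)))"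
      by (rule integrable_exp_minus)
    show "AE y in lborel. (\<lambda>n. indicator {0<..} y *\<^sub>R (rho y * (u n y)^2)) \<longlonglongrightarrow> 0"
    proof (rule AE_I2)
      fix y :: real
      show "(\<lambda>n. indicator {0<..} y *\<^sub>R (rho y * (u n y)^2)) \<longlonglongrightarrow> 0"
      proof (cases "y > 0")
        case True
        have "(\<lambda>n. rho y * (u n y)^2) \<longlonglongrightarrow> rho y * 0^2" by (intro tendsto_intros lim True)
        then show ?thesis using True by simp
      qed simp
    qed
    show "AE y in lborel. norm (indicator {0<..} y *\<^sub>R (rho y * (u n y)^2)) \<le> indicator {0<..} y * (C^2 * (256 * exp 2) * exp (- y))" for n
      using rho_square_le[OF _ bound] by (intro AE_I2) (auto simp: indicator_def rho_nonneg)
    have [measurable]: "(\<lambda>y. indicator {0<..} y * u n y) \<in> borel_measurable borel" for n by (rule u)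
    show "(\<lambda>y. indicator {0<..} y *\<^sub>R (rho y * (u n y)^2)) \<in> borel_measurable lborel" for n
      unfolding eq by measurable
  qed simp
  then show ?thesis by (simp add: L2rho_norm2_def set_lebesgue_integral_def)
qed

section \<open>The profile and its mode\<close>

locale approximated_profile =
  fixes f0 :: "real \<Rightarrow> real" and D :: "nat \<Rightarrow> real \<Rightarrow> real"
  assumes tower: "smooth_tower_halfline D f0"
    and ode: "\<And>y. y > 0 \<Longrightarrow> D 2 y + (2 / y - y / 2) * D 1 y - sin (2 * f0 y) / y^2 = 0"
    and init: "f0 0 = 0"
    and close0: "\<And>y. y > 0 \<Longrightarrow> \<bar>p1 y * (f0 y - f0_approx y)\<bar> \<le> 5/10000"
    and close1: "\<And>y. y > 0 \<Longrightarrow> \<bar>p3 y * (D 1 y - deriv f0_approx y)\<bar> \<le> 5/10000"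
begin

lemma D_0: "D 0 = f0"
  using tower by (simp add: smooth_tower_halfline_def)

lemma D_deriv: "y > 0 \<Longrightarrow> (D n has_real_derivative D (Suc n) y) (at y)"
proof -
  assume y: "y > 0"
  then have "(D n has_real_derivative D (Suc n) y) (at y within {0..})"
    using tower by (simp add: smooth_tower_halfline_def)
  moreover have "at y within {0..} = at y" by (rule at_within_interior) (use y in simp)
  ultimately show ?thesis by simp
qed

lemma D_continuous: "continuous_on {0..} (D n)"
  using tower unfolding smooth_tower_halfline_def
  by (meson DERIV_continuous atLeast_iff continuous_on_eq_continuous_within)

lemma f0_continuous: "continuous_on {0<..} f0"
proof -
  have "continuous_on {0<..} (D 0)" by (rule continuous_on_subset[OF D_continuous]) auto
  then show ?thesis by (simp add: D_0)
qed

lemma D1_bounded: "\<exists>K. \<forall>y>0. \<bar>D 1 y\<bar> \<le> K"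
proof -
  obtain K where K: "\<And>y. \<bar>deriv f0_approx y\<bar> \<le> K" using f0_approx_deriv_bounded by blast
  have "\<bar>D 1 y\<bar> \<le> K + 1" if y: "y > 0" for y
  proof -
    have "1 * \<bar>D 1 y - deriv f0_approx y\<bar> \<le> p3 y * \<bar>D 1 y - deriv f0_approx y\<bar>"
      by (intro mult_right_mono p3_ge_1) auto
    also have "\<dots> \<le> 5/10000" using close1[OF y] p3_ge_1[of y] by (simp add: abs_mult)
    finally have "\<bar>D 1 y - deriv f0_approx y\<bar> \<le> 1" by simp
    then show ?thesis using K[of y] by linarith
  qed
  then show ?thesis by blast
qed

lemma D1_nonzero: "\<exists>y>0. D 1 y \<noteq> 0"
proof (rule ccontr)
  assume "\<not> (\<exists>y>0. D 1 y \<noteq> 0)"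
  then have "(f0 has_real_derivative 0) (at y)" if "y > 0" for y
    using D_deriv[OF that, of 0] that by (auto simp: D_0)
  moreover have "continuous_on {0..1} f0"
    unfolding D_0[symmetric] by (rule continuous_on_subset[OF D_continuous]) auto
  ultimately have "f0 1 = f0 0" by (intro DERIV_isconst_end) auto
  then have "\<bar>p1 1 * f0_approx 1\<bar> \<le> 5/10000" using close0[of 1] by (simp add: init)
  moreover have "p1 1 \<ge> 1" by (simp add: p1_def)
  ultimately have "\<bar>f0_approx 1\<bar> \<le> 5/10000"
    using mult_right_mono[of 1 "p1 1" "\<bar>f0_approx 1\<bar>"] by (simp add: abs_mult)
  moreover have "f0_approx 1 \<ge> 2 * arctan 1"
  proof -
    have s: "sqrt (2 + 1) \<le> 2" by (rule real_le_lsqrt) auto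
    then have "1 / sqrt (2 + 1) \<ge> 1/2" by (simp add: field_simps)
    moreover have "1 / sqrt (2 + 1) \<le> (1::real)" by simp
    ultimately have "cheb_sum (1 / sqrt (2 + 1)) \<ge> 1"
      using cheb_sum_bounds(1)[of "1 / sqrt (2 + 1)"] by linarith
    then have "arctan (cheb_sum (1 / sqrt (2 + 1))) \<ge> arctan 1" by (rule arctan_monotone')
    then show ?thesis by (simp add: f0_approx_def cheb_sum_def)
  qed
  ultimately show False using pi_gt3 by (simp add: arctan_one)
qed

definition mode :: "real \<Rightarrow> real" where
  "mode y = (if y > 0 then y * D 1 y else 0)"

lemma mode_measurable: "mode \<in> borel_measurable borel"
proof -
  have "(\<lambda>y. indicator {0<..} y *\<^sub>R (y * D 1 y)) \<in> borel_measurable borel"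
    by (intro borel_measurable_continuous_on_indicator continuous_intros continuous_on_subset[OF D_continuous]) auto
  moreover have "(\<lambda>y. indicator {0<..} y *\<^sub>R (y * D 1 y)) = mode"
    by (auto simp: mode_def fun_eq_iff)
  ultimately show ?thesis by simp
qed

text \<open>The set where \<open>D 1\<close> is nonzero is open in the half-line and nonempty, hence
  not negligible.\<close>

lemma mode_not_null: "\<not> (AE y in lborel. y > 0 \<longrightarrow> mode y = 0)"
proof
  assume "AE y in lborel. y > 0 \<longrightarrow> mode y = 0"
  then obtain N where N: "N \<in> null_sets lborel" "{y. \<not> (y > 0 \<longrightarrow> mode y = 0)} \<subseteq> N"
    by (auto elim: AE_E simp: null_sets_def)
  let ?U = "{0<..} \<inter> D 1 -` (- {0})"
  have "open ?U"
    by (intro continuous_open_preimage continuous_on_subset[OF D_continuous]) auto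
  have "negligible N" using N(1) by (simp add: negligible_iff_null_sets null_sets_completionI)
  moreover have "?U \<subseteq> N" using N(2) by (auto simp: mode_def)
  ultimately have "negligible ?U" by (rule negligible_subset)
  moreover have "?U \<noteq> {}" using D1_nonzero by auto
  ultimately show False using open_not_negligible[OF \<open>open ?U\<close>] by simp
qed

definition mode' :: "real \<Rightarrow> real" where "mode' y = D 1 y + y * D 2 y"

definition mode'' :: "real \<Rightarrow> real" where "mode'' y = 2 * D 2 y + y * D 3 y"

lemma mode_deriv:
  assumes "y > 0"
  shows "((\<lambda>y. y * D 1 y) has_real_derivative mode' y) (at y)"
    "(mode' has_real_derivative mode'' y) (at y)"
  using D_deriv[OF assms, of 1] D_deriv[OF assms, of 2] unfolding mode'_def[abs_def] mode''_def
  by (auto intro!: derivative_eq_intros simp: numeral_3_eq_3 numeral_2_eq_2)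

text \<open>With \<open>E\<close> the left side of the profile equation, the operator applied to
  \<open>y * D 1 y\<close>, plus \<open>y * D 1 y\<close>, equals \<open>- y * E' - 2 * E\<close>,
  which is minus the derivative of \<open>y^2 * E\<close> divided by \<open>y\<close>. This is the
  scaling derivative of the equation, and \<open>E\<close> vanishes identically.\<close>

lemma mode_eigen:
  assumes y: "y > 0"
  shows "- mode'' y - (2 / y - y / 2) * mode' y + 2 * cos (2 * f0 y) / y^2 * (y * D 1 y) = - (y * D 1 y)"
proof -
  define E where "E y = D 2 y + (2 / y - y / 2) * D 1 y - sin (2 * f0 y) / y^2" for y
  define E' where "E' = D 3 y + ((- 2 / y^2 - 1/2) * D 1 y + (2 / y - y / 2) * D 2 y)
      - (2 * cos (2 * f0 y) * D 1 y / y^2 - 2 * sin (2 * f0 y) / y^3)"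
  have "(E has_real_derivative E') (at y)"
    unfolding E_def[abs_def] E'_def using y D_deriv[OF y, of 0] D_deriv[OF y, of 1] D_deriv[OF y, of 2]
    by (auto intro!: derivative_eq_intros simp: D_0 numeral_3_eq_3 numeral_2_eq_2 field_simps)
  moreover have "(E has_real_derivative 0) (at y)"
    by (rule has_field_derivative_transform_within_open[of "\<lambda>_. 0" _ _ "{0<..}"]) (use y ode in \<open>auto simp: E_def\<close>)
  ultimately have "E' = 0" by (rule DERIV_unique)
  moreover have "E y = 0" using ode[OF y] by (simp add: E_def)
  moreover have "- mode'' y - (2 / y - y / 2) * mode' y + 2 * cos (2 * f0 y) / y^2 * (y * D 1 y) + y * D 1 y
     = - y * E' - 2 * E y"
    unfolding E'_def E_def mode'_def mode''_def using y by (simp add: field_simps power2_eq_square power3_eq_cube)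
  ultimately show ?thesis by simp
qed

text \<open>The norm controls only the first derivative of \<open>f0\<close>. The second is bounded
  on \<open>[0, 1]\<close> by compactness, the tower being continuous up to 0, and beyond 1 it is
  eliminated by the equation, at the cost of a factor of order \<open>y^2\<close>.\<close>

lemma mode_bounds:
  "\<exists>K. \<forall>y>0. \<bar>y * D 1 y\<bar> \<le> K * y \<and> \<bar>mode' y\<bar> \<le> K * (1 + y^2)"
proof -
  obtain K where K: "\<And>y. y > 0 \<Longrightarrow> \<bar>D 1 y\<bar> \<le> K" using D1_bounded by blast
  have K0: "K \<ge> 0" using K[of 1] by auto
  have "continuous_on {0..1} (D 2)" by (rule continuous_on_subset[OF D_continuous]) auto
  then have "bounded (D 2 ` {0..1})" by (intro compact_imp_bounded compact_continuous_image) auto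
  then obtain L where L: "\<forall>v\<in>D 2 ` {0..1}. norm v \<le> L" unfolding bounded_iff by blast
  have L0: "L \<ge> 0" using L by (force intro: order_trans[OF norm_ge_zero])
  have "\<bar>y * D 1 y\<bar> \<le> (5 * K + L + 1) * y \<and> \<bar>mode' y\<bar> \<le> (5 * K + L + 1) * (1 + y^2)" if y: "y > 0" for y
  proof
    have "\<bar>y * D 1 y\<bar> \<le> K * y" using K[OF y] y by (simp add: abs_mult)
    also have "\<dots> \<le> (5 * K + L + 1) * y" using K0 L0 y by (intro mult_right_mono) auto
    finally show "\<bar>y * D 1 y\<bar> \<le> (5 * K + L + 1) * y" .
    have y2: "y \<le> 1 + y^2"
      using zero_le_power2[of "y - 1"] y unfolding power2_diff by (simp add: power2_eq_square)
    show "\<bar>mode' y\<bar> \<le> (5 * K + L + 1) * (1 + y^2)"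
    proof (cases "y \<le> 1")
      case True
      then have "\<bar>D 2 y\<bar> \<le> L" using L y by auto
      then have "\<bar>y * D 2 y\<bar> \<le> 1 * L" unfolding abs_mult using True y by (intro mult_mono) auto
      then have "\<bar>mode' y\<bar> \<le> K + L" using K[OF y] unfolding mode'_def by linarith
      also have "\<dots> \<le> (5 * K + L + 1) * 1" using K0 by simp
      also have "\<dots> \<le> (5 * K + L + 1) * (1 + y^2)" using K0 L0 by (intro mult_left_mono) auto
      finally show ?thesis .
    next
      case False
      have "D 2 y = sin (2 * f0 y) / y^2 - (2 / y - y / 2) * D 1 y"
        using ode[OF y] by linarith
      then have "y * D 2 y = sin (2 * f0 y) / y - (2 - y^2 / 2) * D 1 y"
        using y by (simp add: field_simps power2_eq_square)
      then have "mode' y = sin (2 * f0 y) / y + (y^2 / 2 - 1) * D 1 y"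
        by (simp add: mode'_def algebra_simps)
      then have "\<bar>mode' y\<bar> \<le> \<bar>sin (2 * f0 y)\<bar> / y + \<bar>y^2 / 2 - 1\<bar> * \<bar>D 1 y\<bar>"
        using y abs_triangle_ineq[of "sin (2 * f0 y) / y" "(y^2 / 2 - 1) * D 1 y"] by (simp add: abs_mult)
      also have "\<dots> \<le> 1 / 1 + (1 + y^2) * K"
      proof (intro add_mono frac_le mult_mono K[OF y])
        show "\<bar>y^2 / 2 - 1\<bar> \<le> 1 + y^2" using zero_le_power2[of y] by linarith
      qed (use False y in auto)
      also have "\<dots> \<le> (1 + y^2) * 1 + (1 + y^2) * K" by simp
      also have "\<dots> = (1 + K) * (1 + y^2)" by (simp add: algebra_simps)
      also have "\<dots> \<le> (5 * K + L + 1) * (1 + y^2)" using K0 L0 by (intro mult_right_mono) auto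
      finally show ?thesis .
    qed
  qed
  then show ?thesis by blast
qed

lemma mode_square_integrable: "square_integrable rho_measure mode"
proof -
  obtain K where K: "\<forall>y>0. \<bar>y * D 1 y\<bar> \<le> K * y \<and> \<bar>mode' y\<bar> \<le> K * (1 + y^2)" using mode_bounds by blast
  have "\<bar>1 * D 1 1\<bar> \<le> K * 1" using K by (metis zero_less_one)
  then have K0: "K \<ge> 0" by auto
  show ?thesis
  proof (rule square_integrable_rho_measureI[OF mode_measurable])
    fix y :: real assume y: "y > 0"
    have "\<bar>y * mode y\<bar> = y * \<bar>y * D 1 y\<bar>" using y by (simp add: mode_def abs_mult)
    also have "\<dots> \<le> y * (K * y)" using K y by (intro mult_left_mono) auto
    also have "\<dots> \<le> K * (1 + y^2)" using K0 by (simp add: algebra_simps power2_eq_square)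
    finally show "\<bar>y * mode y\<bar> \<le> K * (1 + y^2)" .
  qed
qed

text \<open>Multiplying the mode by the cutoffs gives test functions. The errors in the function and
  in its image vanish eventually at each point and, by the scale invariant bounds, share one
  majorant of the kind \<open>rho_square_le\<close> accepts.\<close>

lemma mode_in_graph: "A0_closure_graph f0 mode (\<lambda>y. - 1 * mode y)"
proof -
  obtain K where K: "\<forall>y>0. \<bar>y * D 1 y\<bar> \<le> K * y \<and> \<bar>mode' y\<bar> \<le> K * (1 + y^2)" using mode_bounds by blast
  obtain \<theta> \<theta>' \<theta>'' :: "nat \<Rightarrow> real \<Rightarrow> real" and L where \<theta>: "\<forall>n. smooth_on UNIV (\<theta> n) \<and>
    (\<forall>x. (\<theta> n has_real_derivative \<theta>' n x) (at x)) \<and>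
    (\<forall>x. (\<theta>' n has_real_derivative \<theta>'' n x) (at x)) \<and>
    (\<exists>a b. 0 < a \<and> a < b \<and> (\<forall>x. x \<notin> {a..b} \<longrightarrow> \<theta> n x = 0)) \<and>
    (\<forall>x. \<bar>\<theta> n x\<bar> \<le> L \<and> \<bar>x * \<theta>' n x\<bar> \<le> L \<and> \<bar>x^2 * \<theta>'' n x\<bar> \<le> L) \<and>
    (\<forall>x>0. \<forall>\<^sub>F n in sequentially. \<theta> n x = 1 \<and> \<theta>' n x = 0 \<and> \<theta>'' n x = 0)"
    using cutoff_functions by blast
  have d\<theta>: "(\<theta> n has_real_derivative \<theta>' n x) (at x)" "(\<theta>' n has_real_derivative \<theta>'' n x) (at x)" for n x
    using \<theta> by auto
  have b\<theta>: "\<bar>\<theta> n x\<bar> \<le> L" "\<bar>x * \<theta>' n x\<bar> \<le> L" "\<bar>x^2 * \<theta>'' n x\<bar> \<le> L" for n x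
    using \<theta> by auto
  have ev\<theta>: "\<forall>\<^sub>F n in sequentially. \<theta> n x = 1 \<and> \<theta>' n x = 0 \<and> \<theta>'' n x = 0" if "x > 0" for x
    using \<theta> that by auto
  have "\<bar>1 * D 1 1\<bar> \<le> K * 1" using K by (metis zero_less_one)
  then have K0: "K \<ge> 0" by auto
  have L0: "L \<ge> 0" using b\<theta>(1)[of 0 0] by auto
  define \<phi> where "\<phi> n y = \<theta> n y * (y * D 1 y)" for n y
  have test: "test_fun (\<phi> n)" for n
  proof -
    obtain a b where ab: "0 < a" "a < b" "\<forall>x. x \<notin> {a..b} \<longrightarrow> \<theta> n x = 0" using \<theta> by blast
    have "smooth_on {0<..} (D 1)"
      unfolding smooth_on_def using D_deriv by (intro exI[of _ "\<lambda>n. D (Suc n)"]) auto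
    moreover have "smooth_on UNIV (\<theta> n)" using \<theta> by blast
    ultimately have "smooth_on {0<..} (\<phi> n)"
      unfolding \<phi>_def[abs_def]
      by (intro smooth_on_mult smooth_on_ident) (auto elim: smooth_on_subset)
    then have "smooth_on UNIV (\<phi> n)"
      by (rule smooth_on_extend_zero[OF _ ab(1)]) (use ab in \<open>auto simp: \<phi>_def\<close>)
    moreover have "\<forall>x. x \<notin> {a..b} \<longrightarrow> \<phi> n x = 0" using ab by (simp add: \<phi>_def)
    ultimately show ?thesis unfolding test_fun_iff using ab by blast
  qed
  \<comment> \<open>The first term is the missing part of the mode, from the eigenvalue -1; the
    others are the commutator of the operator with the cutoff.\<close>
  define err where "err n y = (1 - \<theta> n y) * (y * D 1 y) - 2 * \<theta>' n y * mode' y - \<theta>'' n y * (y * D 1 y)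
      - (2 / y - y / 2) * (\<theta>' n y * (y * D 1 y))" for n y
  have A: "A0 f0 (\<phi> n) y - - 1 * mode y = err n y" if y: "y > 0" for n y
  proof -
    have d1: "(\<phi> n has_real_derivative \<theta>' n x * (x * D 1 x) + mode' x * \<theta> n x) (at x)" if "x > 0" for x
      unfolding \<phi>_def[abs_def] by (rule DERIV_mult[OF d\<theta>(1) mode_deriv(1)[OF that]])
    have d2: "((\<lambda>y. \<theta>' n y * (y * D 1 y) + mode' y * \<theta> n y) has_real_derivative
        (\<theta>'' n y * (y * D 1 y) + mode' y * \<theta>' n y) + (mode'' y * \<theta> n y + \<theta>' n y * mode' y)) (at y)"
      by (rule DERIV_add[OF DERIV_mult[OF d\<theta>(2) mode_deriv(1)[OF y]] DERIV_mult[OF mode_deriv(2)[OF y] d\<theta>(1)]])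
    have "A0 f0 (\<phi> n) y = - ((\<theta>'' n y * (y * D 1 y) + mode' y * \<theta>' n y) + (mode'' y * \<theta> n y + \<theta>' n y * mode' y))
        - (2 / y - y / 2) * (\<theta>' n y * (y * D 1 y) + mode' y * \<theta> n y) + 2 * cos (2 * f0 y) / y^2 * \<phi> n y"
      by (rule A0_eq[OF y d1 d2])
    also have "\<dots> = \<theta> n y * (- mode'' y - (2 / y - y / 2) * mode' y + 2 * cos (2 * f0 y) / y^2 * (y * D 1 y))
       - 2 * \<theta>' n y * mode' y - \<theta>'' n y * (y * D 1 y) - (2 / y - y / 2) * (\<theta>' n y * (y * D 1 y))"
      by (simp add: \<phi>_def algebra_simps)
    finally show ?thesis unfolding mode_eigen[OF y] using y by (simp add: err_def mode_def algebra_simps)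
  qed
  define M where "M = 8 * (1 + L) * K"
  have boundw: "\<bar>y * (\<phi> n y - mode y)\<bar> \<le> M * (1 + y^2)" and bounde: "\<bar>y * err n y\<bar> \<le> M * (1 + y^2)" if y: "y > 0" for n y
  proof -
    have w: "\<bar>y * D 1 y\<bar> \<le> K * y" "\<bar>mode' y\<bar> \<le> K * (1 + y^2)" using K y by auto
    have 1: "\<bar>y * ((1 - \<theta> n y) * (y * D 1 y))\<bar> \<le> (1 + L) * (K * y^2)"
    proof -
      have "\<bar>1 - \<theta> n y\<bar> \<le> 1 + L" using b\<theta>(1)[of n y] by linarith
      then have "\<bar>1 - \<theta> n y\<bar> * (y * \<bar>y * D 1 y\<bar>) \<le> (1 + L) * (y * (K * y))"
        using w y L0 by (intro mult_mono) auto
      then show ?thesis using y by (simp add: abs_mult power2_eq_square mult_ac)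
    qed
    have 2: "\<bar>y * (2 * \<theta>' n y * mode' y)\<bar> \<le> 2 * (L * (K * (1 + y^2)))"
    proof -
      have "\<bar>y * \<theta>' n y\<bar> * \<bar>mode' y\<bar> \<le> L * (K * (1 + y^2))"
        using w b\<theta>(2)[of y n] L0 by (intro mult_mono) auto
      then have "2 * (\<bar>y * \<theta>' n y\<bar> * \<bar>mode' y\<bar>) \<le> 2 * (L * (K * (1 + y^2)))" by simp
      then show ?thesis by (simp add: abs_mult mult_ac)
    qed
    have 3: "\<bar>y * (\<theta>'' n y * (y * D 1 y))\<bar> \<le> L * K"
    proof -
      have "y * \<bar>\<theta>'' n y\<bar> * \<bar>y * D 1 y\<bar> \<le> y * \<bar>\<theta>'' n y\<bar> * (K * y)"
        using w y by (intro mult_left_mono) auto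
      also have "\<dots> = K * \<bar>y^2 * \<theta>'' n y\<bar>" using y by (simp add: abs_mult power2_eq_square)
      also have "\<dots> \<le> K * L" using b\<theta>(3)[of y n] K0 by (intro mult_left_mono) auto
      finally show ?thesis using y by (simp add: abs_mult mult_ac)
    qed
    have 4: "\<bar>y * ((2 / y - y / 2) * (\<theta>' n y * (y * D 1 y)))\<bar> \<le> (2 + y^2) * (L * K)"
    proof -
      have "\<bar>\<theta>' n y\<bar> * \<bar>y * D 1 y\<bar> \<le> \<bar>\<theta>' n y\<bar> * (K * y)" using w by (intro mult_left_mono) auto
      also have "\<dots> = K * \<bar>y * \<theta>' n y\<bar>" using y by (simp add: abs_mult)
      also have "\<dots> \<le> K * L" using b\<theta>(2)[of y n] K0 by (intro mult_left_mono) auto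
      finally have "\<bar>\<theta>' n y * (y * D 1 y)\<bar> \<le> L * K" by (simp add: abs_mult mult_ac)
      moreover have "\<bar>y * (2 / y - y / 2)\<bar> \<le> 2 + y^2"
      proof -
        have "y * (2 / y - y / 2) = 2 - y^2 / 2" using y by (simp add: field_simps power2_eq_square)
        then show ?thesis using zero_le_power2[of y] by linarith
      qed
      ultimately have "\<bar>y * (2 / y - y / 2)\<bar> * \<bar>\<theta>' n y * (y * D 1 y)\<bar> \<le> (2 + y^2) * (L * K)"
        by (intro mult_mono) auto
      then show ?thesis by (simp only: abs_mult[symmetric] mult.assoc)
    qed
    have LK: "L * K \<ge> 0" "L * K * y^2 \<ge> 0" "K * y^2 \<ge> 0" using L0 K0 by auto
    have M: "M * (1 + y^2) = 8 * K + 8 * (L * K) + 8 * (K * y^2) + 8 * (L * K * y^2)"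
      by (simp add: M_def algebra_simps)
    have "y * (\<phi> n y - mode y) = - (y * ((1 - \<theta> n y) * (y * D 1 y)))"
      using y by (simp add: \<phi>_def mode_def algebra_simps)
    then show "\<bar>y * (\<phi> n y - mode y)\<bar> \<le> M * (1 + y^2)"
      using 1 LK K0 unfolding M by (simp add: algebra_simps)
    have "y * err n y = y * ((1 - \<theta> n y) * (y * D 1 y)) - y * (2 * \<theta>' n y * mode' y) - y * (\<theta>'' n y * (y * D 1 y))
      - y * ((2 / y - y / 2) * (\<theta>' n y * (y * D 1 y)))"
      unfolding err_def by (simp only: right_diff_distrib)
    then have "\<bar>y * err n y\<bar> \<le> (1 + L) * (K * y^2) + 2 * (L * (K * (1 + y^2))) + L * K + (2 + y^2) * (L * K)"
      using 1 2 3 4 by linarith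
    also have "\<dots> = K * y^2 + 4 * (L * K * y^2) + 5 * (L * K)" by (simp add: algebra_simps)
    also have "\<dots> \<le> M * (1 + y^2)" unfolding M using LK K0 by linarith
    finally show "\<bar>y * err n y\<bar> \<le> M * (1 + y^2)" .
  qed
  have s: "square_integrable rho_measure (\<phi> n)" "square_integrable rho_measure (A0_ext f0 (\<phi> n))" for n
    using test_data_exists[OF test[of n]] test_data_square_integrable[OF f0_continuous] by blast+
  have meas: "\<phi> n \<in> borel_measurable borel" "A0_ext f0 (\<phi> n) \<in> borel_measurable borel" for n
    using s[of n] by (auto simp: square_integrable_def)
  note [measurable] = meas mode_measurable
  have lim1: "(\<lambda>n. L2rho_norm2 (\<lambda>y. \<phi> n y - mode y)) \<longlonglongrightarrow> 0"
  proof (rule L2rho_norm2_tendsto_0[OF _ boundw])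
    fix y :: real assume "y > 0"
    from ev\<theta>[OF this] have "\<forall>\<^sub>F n in sequentially. \<phi> n y - mode y = 0"
      by eventually_elim (use \<open>y > 0\<close> in \<open>auto simp: \<phi>_def mode_def\<close>)
    then show "(\<lambda>n. \<phi> n y - mode y) \<longlonglongrightarrow> 0" by (rule tendsto_eventually)
  qed measurable
  have lim2: "(\<lambda>n. L2rho_norm2 (err n)) \<longlonglongrightarrow> 0"
  proof (rule L2rho_norm2_tendsto_0[OF _ bounde])
    fix n
    have "(\<lambda>y. indicator {0<..} y * (A0_ext f0 (\<phi> n) y + mode y)) \<in> borel_measurable borel" by measurable
    also have "(\<lambda>y. indicator {0<..} y * (A0_ext f0 (\<phi> n) y + mode y)) = (\<lambda>y. indicator {0<..} y * err n y)"
      using A[of _ n] by (auto simp: fun_eq_iff indicator_def A0_ext_def)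
    finally show "(\<lambda>y. indicator {0<..} y * err n y) \<in> borel_measurable borel" .
  next
    fix y :: real assume "y > 0"
    from ev\<theta>[OF this] have "\<forall>\<^sub>F n in sequentially. err n y = 0"
      by eventually_elim (auto simp: err_def)
    then show "(\<lambda>n. err n y) \<longlonglongrightarrow> 0" by (rule tendsto_eventually)
  qed
  have "L2rho_norm2 (\<lambda>y. A0 f0 (\<phi> n) y - - 1 * mode y) = L2rho_norm2 (err n)" for n
    by (rule L2rho_norm2_cong) (rule A)
  then have "(\<lambda>n. L2rho_norm2 (\<lambda>y. A0 f0 (\<phi> n) y - - 1 * mode y)) \<longlonglongrightarrow> 0" using lim2 by simp
  moreover have "L2rho mode" "L2rho (\<lambda>y. - 1 * mode y)"
    unfolding L2rho_iff using mode_square_integrable square_integrable_lincomb[OF mode_square_integrable mode_square_integrable, of "-1" 0]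
    by simp_all
  ultimately show ?thesis
    unfolding A0_closure_graph_def using test lim1 by blast
qed

end

section \<open>Uniqueness of the nonpositive eigenvalue\<close>

lemma A0_closure_graph_limits:
  assumes f0: "continuous_on {0<..} f0" and graph: "A0_closure_graph f0 w g"
  shows "square_integrable rho_measure w \<and> square_integrable rho_measure g \<and>
    (\<exists>\<phi>. (\<forall>n. test_fun (\<phi> n)) \<and> (\<lambda>n. \<integral>y. (\<phi> n y - w y)^2 \<partial>rho_measure) \<longlonglongrightarrow> 0
      \<and> (\<lambda>n. \<integral>y. (A0_ext f0 (\<phi> n) y - g y)^2 \<partial>rho_measure) \<longlonglongrightarrow> 0)"
proof -
  have s: "square_integrable rho_measure w" "square_integrable rho_measure g"
    using graph by (auto simp: A0_closure_graph_def L2rho_iff)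
  obtain \<phi> where \<phi>: "\<forall>n. test_fun (\<phi> n)" "(\<lambda>n. L2rho_norm2 (\<lambda>y. \<phi> n y - w y)) \<longlonglongrightarrow> 0"
    "(\<lambda>n. L2rho_norm2 (\<lambda>y. A0 f0 (\<phi> n) y - g y)) \<longlonglongrightarrow> 0"
    using graph unfolding A0_closure_graph_def by blast
  have t: "square_integrable rho_measure (\<phi> n)" "square_integrable rho_measure (A0_ext f0 (\<phi> n))" for n
    using test_data_exists[of "\<phi> n"] \<phi>(1) test_data_square_integrable[OF f0] by blast+
  have m: "w \<in> borel_measurable borel" "g \<in> borel_measurable borel"
      "\<phi> n \<in> borel_measurable borel" "A0_ext f0 (\<phi> n) \<in> borel_measurable borel" for n
    using s t[of n] by (simp_all add: square_integrable_def)
  have 1: "L2rho_norm2 (\<lambda>y. \<phi> n y - w y) = (\<integral>y. (\<phi> n y - w y)^2 \<partial>rho_measure)" for n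
    by (intro L2rho_norm2_eq borel_measurable_diff m)
  have "L2rho_norm2 (\<lambda>y. A0 f0 (\<phi> n) y - g y) = L2rho_norm2 (\<lambda>y. A0_ext f0 (\<phi> n) y - g y)" for n
    by (rule L2rho_norm2_cong) (simp add: A0_ext_def)
  also have "L2rho_norm2 (\<lambda>y. A0_ext f0 (\<phi> n) y - g y) = (\<integral>y. (A0_ext f0 (\<phi> n) y - g y)^2 \<partial>rho_measure)" for n
    by (intro L2rho_norm2_eq borel_measurable_diff m)
  finally show ?thesis using s \<phi> 1 by auto
qed

lemma integral_square_pos:
  assumes w: "square_integrable rho_measure w" and nz: "\<not> (AE y in lborel. y > 0 \<longrightarrow> w y = 0)"
  shows "(\<integral>y. w y * w y \<partial>rho_measure) > 0"
proof (rule ccontr)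
  assume "\<not> ?thesis"
  moreover have "(\<integral>y. w y * w y \<partial>rho_measure) \<ge> 0" by simp
  ultimately have "(\<integral>y. w y * w y \<partial>rho_measure) = 0" by linarith
  then have "AE y in rho_measure. w y * w y = 0"
    using square_integrable_mult[OF w w] by (subst (asm) integral_nonneg_eq_0_iff_AE) auto
  then have "AE y in lborel. 0 < ennreal (indicator {0<..} y * rho y) \<longrightarrow> w y * w y = 0"
    unfolding rho_measure_def by (subst (asm) AE_density) auto
  then have "AE y in lborel. y > 0 \<longrightarrow> w y = 0"
    by eventually_elim (auto simp: rho_def)
  with nz show False by simp
qed

text \<open>Two orthogonal eigenvectors with eigenvalues at most \<open>0\<close> would make the form nonpositive on the
  plane they span; but among the approximating test functions some combination vanishes
  at \<open>sqrt (3/10)\<close>.\<close>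

lemma (in approximated_profile) nonpos_eigenvalue_unique:
  assumes l: "l \<le> 0" and eig: "A0_eigenvalue f0 l"
  shows "l = -1"
proof (rule ccontr)
  assume l1: "l \<noteq> -1"
  let ?I = "\<lambda>u v. (\<integral>y. u y * v y \<partial>rho_measure)"
  let ?A = "A0_ext f0"
  obtain w where nz: "\<not> (AE y in lborel. y > 0 \<longrightarrow> w y = 0)" and gw: "A0_closure_graph f0 w (\<lambda>y. l * w y)"
    using eig unfolding A0_eigenvalue_def by blast
  obtain \<phi> where sw: "square_integrable rho_measure w" "square_integrable rho_measure (\<lambda>y. l * w y)"
    and t\<phi>: "\<And>n. test_fun (\<phi> n)" and l\<phi>: "(\<lambda>n. \<integral>y. (\<phi> n y - w y)^2 \<partial>rho_measure) \<longlonglongrightarrow> 0"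
      "(\<lambda>n. \<integral>y. (?A (\<phi> n) y - l * w y)^2 \<partial>rho_measure) \<longlonglongrightarrow> 0"
    using A0_closure_graph_limits[OF f0_continuous gw] by auto
  obtain \<psi> where sv: "square_integrable rho_measure mode" "square_integrable rho_measure (\<lambda>y. - 1 * mode y)"
    and t\<psi>: "\<And>n. test_fun (\<psi> n)" and l\<psi>: "(\<lambda>n. \<integral>y. (\<psi> n y - mode y)^2 \<partial>rho_measure) \<longlonglongrightarrow> 0"
      "(\<lambda>n. \<integral>y. (?A (\<psi> n) y - - 1 * mode y)^2 \<partial>rho_measure) \<longlonglongrightarrow> 0"
    using A0_closure_graph_limits[OF f0_continuous mode_in_graph] by blast
  have sq: "square_integrable rho_measure \<eta>" "square_integrable rho_measure (?A \<eta>)" if "test_fun \<eta>" for \<eta>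
    using test_data_exists[OF that] test_data_square_integrable[OF f0_continuous] by blast+
  note s\<phi> = sq[OF t\<phi>] and s\<psi> = sq[OF t\<psi>]
  note lim = tendsto_integral_mult[where M = rho_measure]
  have "(\<lambda>n. ?I (?A (\<phi> n)) (\<psi> n)) \<longlonglongrightarrow> ?I (\<lambda>y. l * w y) mode"
    by (rule lim[OF s\<phi>(2) sw(2) s\<psi>(1) sv(1) l\<phi>(2) l\<psi>(1)])
  moreover have c2: "(\<lambda>n. ?I (\<phi> n) (?A (\<psi> n))) \<longlonglongrightarrow> ?I w (\<lambda>y. - 1 * mode y)"
    by (rule lim[OF s\<phi>(1) sw(1) s\<psi>(2) sv(2) l\<phi>(1) l\<psi>(2)])
  \<comment> \<open>Symmetry on test functions survives in the limit, so eigenvectors for the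
    different values \<open>l\<close> and -1 are orthogonal.\<close>
  ultimately have "?I (\<lambda>y. l * w y) mode = ?I w (\<lambda>y. - 1 * mode y)"
    unfolding A0_symmetric[OF f0_continuous t\<phi> t\<psi>] by (rule LIMSEQ_unique)
  then have "(l + 1) * ?I w mode = 0" by (simp add: mult.assoc algebra_simps)
  then have orth: "?I w mode = 0" using l1 by simp
  \<comment> \<open>Entries of the matrix of the form minus \<open>1/200\<close> times the Gram
    matrix, on the plane spanned by the two approximants. The limit is diagonal by orthogonality,
    with negative entries because \<open>l\<close> and -1 lie below \<open>1/200\<close>.\<close>
  define p where "p n = ?I (\<phi> n) (?A (\<phi> n)) - 1/200 * ?I (\<phi> n) (\<phi> n)" for n
  define q where "q n = ?I (\<phi> n) (?A (\<psi> n)) - 1/200 * ?I (\<phi> n) (\<psi> n)" for n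
  define r where "r n = ?I (\<psi> n) (?A (\<psi> n)) - 1/200 * ?I (\<psi> n) (\<psi> n)" for n
  have "p \<longlonglongrightarrow> ?I w (\<lambda>y. l * w y) - 1/200 * ?I w w"
    unfolding p_def by (intro tendsto_diff tendsto_mult tendsto_const lim s\<phi> sw l\<phi>)
  then have p: "p \<longlonglongrightarrow> - ((1/200 - l) * ?I w w)" by (simp add: algebra_simps)
  have "q \<longlonglongrightarrow> ?I w (\<lambda>y. - 1 * mode y) - 1/200 * ?I w mode"
    unfolding q_def by (intro tendsto_diff tendsto_mult tendsto_const lim s\<phi> sw l\<phi> s\<psi> sv l\<psi>)
  then have q: "q \<longlonglongrightarrow> 0" by (simp add: orth)
  have "r \<longlonglongrightarrow> ?I mode (\<lambda>y. - 1 * mode y) - 1/200 * ?I mode mode"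
    unfolding r_def by (intro tendsto_diff tendsto_mult tendsto_const lim s\<psi> sv l\<psi>)
  then have r: "r \<longlonglongrightarrow> - (201/200 * ?I mode mode)" by simp
  have pos: "?I w w > 0" "?I mode mode > 0"
    using integral_square_pos[OF sw(1) nz] integral_square_pos[OF sv(1) mode_not_null] by auto
  define P where "P = (1/200 - l) * ?I w w"
  define R where "R = 201/200 * ?I mode mode"
  have PR: "P > 0" "R > 0" using pos l by (simp_all add: P_def R_def)
  \<comment> \<open>Half of the smaller diagonal entry: once both diagonal terms are below
    \<open>- c\<close> and the off-diagonal one is less than \<open>c\<close> in size, the matrix is
    negative definite.\<close>
  define c where "c = min P R / 2"
  have c: "c > 0" "- P < - c" "- R < - c" using PR by (auto simp: c_def min_def)
  have "\<forall>\<^sub>F n in sequentially. p n < - c"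
    by (rule order_tendstoD(2)[OF p[folded P_def] c(2)])
  moreover have "\<forall>\<^sub>F n in sequentially. r n < - c"
    by (rule order_tendstoD(2)[OF r[folded R_def] c(3)])
  moreover have "\<forall>\<^sub>F n in sequentially. \<bar>q n\<bar> < c"
    using tendstoD[OF q c(1)] by simp
  ultimately have "\<forall>\<^sub>F n in sequentially. False"
  proof eventually_elim
    fix n assume n: "p n < - c" "r n < - c" "\<bar>q n\<bar> < c"
    let ?s = "sqrt (3/10)"
    \<comment> \<open>A nontrivial solution of one linear equation in two unknowns. No normalisation
      and no convergence in \<open>n\<close> is required, since the contradiction arises at a single
      index and is homogeneous in \<open>a\<close> and \<open>b\<close>.\<close>
    obtain a b where ab: "a * \<phi> n ?s + b * \<psi> n ?s = 0" "a \<noteq> 0 \<or> b \<noteq> 0"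
    proof (cases "\<phi> n ?s = 0")
      case True
      then show ?thesis using that[of 1 0] by simp
    next
      case False
      then show ?thesis using that[of "\<psi> n ?s" "- \<phi> n ?s"] by simp
    qed
    let ?\<eta> = "\<lambda>y. a * \<phi> n y + b * \<psi> n y"
    have t: "test_fun ?\<eta>" by (rule test_fun_lincomb[OF t\<phi> t\<psi>])
    have A\<eta>: "?A ?\<eta> y = a * ?A (\<phi> n) y + b * ?A (\<psi> n) y" for y
      by (rule A0_ext_lincomb[OF t\<phi> t\<psi>])
    have sym: "?I (\<psi> n) (?A (\<phi> n)) = ?I (\<phi> n) (?A (\<psi> n))"
      using A0_symmetric[OF f0_continuous t\<phi>[of n] t\<psi>[of n]] by (simp add: mult.commute)
    have i: "integrable rho_measure (\<lambda>y. \<phi> n y * ?A (\<phi> n) y)" "integrable rho_measure (\<lambda>y. \<phi> n y * ?A (\<psi> n) y)"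
      "integrable rho_measure (\<lambda>y. \<psi> n y * ?A (\<phi> n) y)" "integrable rho_measure (\<lambda>y. \<psi> n y * ?A (\<psi> n) y)"
      by (intro square_integrable_mult s\<phi> s\<psi>)+
    have "?I ?\<eta> (?A ?\<eta>) = (\<integral>y. a * a * (\<phi> n y * ?A (\<phi> n) y) + a * b * (\<phi> n y * ?A (\<psi> n) y)
        + a * b * (\<psi> n y * ?A (\<phi> n) y) + b * b * (\<psi> n y * ?A (\<psi> n) y) \<partial>rho_measure)"
      unfolding A\<eta> by (simp add: algebra_simps)
    also have "\<dots> = a * a * ?I (\<phi> n) (?A (\<phi> n)) + 2 * a * b * ?I (\<phi> n) (?A (\<psi> n)) + b * b * ?I (\<psi> n) (?A (\<psi> n))"
      using i by (simp add: sym)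
    finally have 1: "?I ?\<eta> (?A ?\<eta>) = a * a * ?I (\<phi> n) (?A (\<phi> n)) + 2 * a * b * ?I (\<phi> n) (?A (\<psi> n)) + b * b * ?I (\<psi> n) (?A (\<psi> n))" .
    have 2: "?I ?\<eta> ?\<eta> = a * a * ?I (\<phi> n) (\<phi> n) + 2 * a * b * ?I (\<phi> n) (\<psi> n) + b * b * ?I (\<psi> n) (\<psi> n)"
      using integral_square_lincomb[OF s\<phi>(1)[of n] s\<psi>(1)[of n], of a b a b] by (simp add: algebra_simps)
    have "?I ?\<eta> (?A ?\<eta>) \<ge> 1/200 * ?I ?\<eta> ?\<eta>"
      using form_lower_bound[OF f0_continuous close0 t] ab(1) by simp
    then have "0 \<le> a * a * p n + 2 * a * b * q n + b * b * r n"
      unfolding 1 2 p_def q_def r_def by (simp add: algebra_simps)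
    moreover have "2 * a * b * q n \<le> c * (a^2 + b^2)"
    proof -
      have "2 * a * b * q n \<le> 2 * \<bar>a\<bar> * \<bar>b\<bar> * \<bar>q n\<bar>"
        using abs_ge_self[of "2 * a * b * q n"] by (simp add: abs_mult)
      also have "\<dots> \<le> (a^2 + b^2) * c"
        using n(3) sum_squares_bound[of "\<bar>a\<bar>" "\<bar>b\<bar>"] by (intro mult_mono) auto
      finally show ?thesis by (simp add: mult.commute)
    qed
    moreover have "a * a * p n + b * b * r n < - c * (a^2 + b^2)"
    proof -
      have "a^2 * p n \<le> a^2 * (- c)" "b^2 * r n \<le> b^2 * (- c)"
        by (rule mult_left_mono; use n in simp)+
      moreover have "a^2 * p n < a^2 * (- c) \<or> b^2 * r n < b^2 * (- c)"
        using ab(2) mult_strict_left_mono[OF n(1), of "a^2"] mult_strict_left_mono[OF n(2), of "b^2"] by auto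
      ultimately have "a^2 * p n + b^2 * r n < a^2 * (- c) + b^2 * (- c)" by linarith
      then show ?thesis by (simp add: power2_eq_square algebra_simps)
    qed
    ultimately show False by (simp add: algebra_simps)
  qed
  then show False by simp
qed

theorem theorem2:
  fixes f0 :: "real \<Rightarrow> real" and D :: "nat \<Rightarrow> real \<Rightarrow> real"
  assumes smooth: "smooth_tower_halfline D f0"
    and mono: "mono_on {0..} f0 \<or> antimono_on {0..} f0"
    and ode: "\<forall>y>0. D 2 y + (2 / y - y / 2) * D 1 y - sin (2 * f0 y) / y^2 = 0"
    and init: "f0 0 = 0"
    and lim: "\<exists>L. (f0 \<longlongrightarrow> L) at_top"
    and close: "(SUP y\<in>{0<..}. ereal \<bar>p1 y * (f0 y - f0_approx y)\<bar>)
              + (SUP y\<in>{0<..}. ereal \<bar>p3 y * (D 1 y - deriv f0_approx y)\<bar>)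
              \<le> ereal (5 / 10000)"
  shows "{lam. lam \<le> 0 \<and> A0_eigenvalue f0 lam} = {-1}"
proof -
  let ?S1 = "SUP y\<in>{0<..}. ereal \<bar>p1 y * (f0 y - f0_approx y)\<bar>"
  let ?S2 = "SUP y\<in>{0<..}. ereal \<bar>p3 y * (D 1 y - deriv f0_approx y)\<bar>"
  have le1: "ereal \<bar>p1 y * (f0 y - f0_approx y)\<bar> \<le> ?S1" if "y > 0" for y
    by (rule SUP_upper) (use that in simp)
  have le2: "ereal \<bar>p3 y * (D 1 y - deriv f0_approx y)\<bar> \<le> ?S2" if "y > 0" for y
    by (rule SUP_upper) (use that in simp)
  \<comment> \<open>Each supremum is nonnegative, so each is bounded by the sum; this splits the
    norm bound into two pointwise bounds.\<close>
  have nonneg: "0 \<le> ?S1" "0 \<le> ?S2"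
    by (rule order_trans[OF _ le1[of 1]], simp, simp) (rule order_trans[OF _ le2[of 1]], simp, simp)
  have S: "?S1 \<le> ereal (5/10000)" "?S2 \<le> ereal (5/10000)"
    using order_trans[OF add_increasing2[OF nonneg(2) order_refl] close]
      order_trans[OF add_increasing[OF nonneg(1) order_refl] close] by auto
  interpret approximated_profile f0 D
  proof
    show "\<bar>p1 y * (f0 y - f0_approx y)\<bar> \<le> 5/10000" if "y > 0" for y
      using order_trans[OF le1[OF that] S(1)] by simp
    show "\<bar>p3 y * (D 1 y - deriv f0_approx y)\<bar> \<le> 5/10000" if "y > 0" for y
      using order_trans[OF le2[OF that] S(2)] by simp
  qed (use smooth ode init in auto)
  have "A0_eigenvalue f0 (-1)"
    unfolding A0_eigenvalue_def using mode_not_null mode_in_graph by blast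
  then show ?thesis using nonpos_eigenvalue_unique by auto
qed

end
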